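(* Let a discrete-time algorithm $z^+=g(z,s)$ with step size $s>0$ be given, and suppose that it has an equivalent template $X^+=\Phi(X,\sqrt{s})$ with a sufficiently smooth mapping $\Phi:\mathcal X\times\mathbb R_+\to\mathcal X$ satisfying $\Phi(X,0)=X$ for all $X\in\mathcal X$. Let $r\ge 0$ be an integer. Then the $O((\sqrt{s})^r)$-resolution ODE of the algorithm with respect to this equivalent template, $$X'(t)=\Gamma_0(X(t))+\sqrt{s}\,\Gamma_1(X(t))+\cdots+(\sqrt{s})^r\Gamma_r(X(t)),$$ exists uniquely and is given by $$\Gamma_0(X)=\Phi_1(X),\qquad \Gamma_j(X)=\frac{\Phi_{j+1}(X)}{(j+1)!}-\sum_{k=2}^{j+1}\frac{1}{k!}H_{k,j+1-k}(X),\quad 1\le j\le r,$$ where $\Phi_j(X)=\partial_\tau^j\Phi(X,\tau)\big|_{\tau=0}$ for $0\le j\le r+1$, and the mappings $H_{k,i}:\mathcal X\to\mathcal X$ are defined recursively by $$H_{1,i}(X)=\Gamma_i(X),\qquad H_{k,i}(X)=\sum_{l=0}^{i}\nabla H_{k-1,l}(X)\,\Gamma_{i-l}(X),\quad 2\le k\le r+1,\ 0\le i\le r.$$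
   Context: $\mathcal X$ is a finite dimensional Hilbert space with norm $\|\cdot\|$, and $\nabla H$ denotes the Jacobian of a map $H:\mathcal X\to\mathcal X$. Definition ($O((\sqrt{s})^r)$-resolution ODE): given a template $X^+=\Phi(X,\sqrt{s})$ with $\Phi:\mathcal X\times\mathbb R_+\to\mathcal X$ and $\Phi(X,0)=X$ for all $X\in\mathcal X$, an ODE of the form $X'(t)=\Gamma_0(X(t))+\sqrt{s}\,\Gamma_1(X(t))+\cdots+(\sqrt{s})^r\Gamma_r(X(t))$, $X(0)=X$, with coefficient maps $\Gamma_i:\mathcal X\to\mathcal X$ independent of $s$, is called the $O((\sqrt{s})^r)$-resolution ODE of the algorithm with respect to the template if for every $X\in\mathcal X$ its solution satisfies $\|X(\sqrt{s})-X^+\|=o\big((\sqrt{s})^{r+1}\big)$ as $s\to0^+$. *)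

theory Defs
  imports "HOL-Analysis.Analysis" "HOL-Library.Landau_Symbols"
begin

(* C^n regularity on a set S, with derivatives taken within S. For sets such as
   UNIV \<times> {0..} (used below), on which the derivative within S is unique, this is the usual
   notion "smooth up to the boundary". In finite dimension, continuity of x \<mapsto> f' x v for every v
   is the same as continuity of x \<mapsto> f' x. *)
primrec C_k_on :: "nat \<Rightarrow> 'a::euclidean_space set \<Rightarrow> ('a \<Rightarrow> 'b::euclidean_space) \<Rightarrow> bool" where
  "C_k_on 0 S f \<longleftrightarrow> continuous_on S f"
| "C_k_on (Suc n) S f \<longleftrightarrow>
     (\<exists>f'. (\<forall>x\<in>S. (f has_derivative f' x) (at x within S)) \<and> (\<forall>v. C_k_on n S (\<lambda>x. f' x v)))"

(* z^+ = g z s and X^+ = \<Phi> X (sqrt s) are the same iteration up to an invertible change of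
   variables, which may depend on the step size s. *)
definition equivalent_template ::
    "('z \<Rightarrow> real \<Rightarrow> 'z) \<Rightarrow> ('a \<Rightarrow> real \<Rightarrow> 'a) \<Rightarrow> bool" where
  "equivalent_template g \<Phi> \<longleftrightarrow>
     (\<forall>s>0. \<exists>T. bij T \<and> (\<forall>z. T (g z s) = \<Phi> (T z) (sqrt s)))"

(* x is a solution on [0, sqrt s] of x' = \<Gamma> 0 x + sqrt s \<Gamma> 1 x + ... + (sqrt s)^r \<Gamma> r x, x(0) = X. *)
definition solves_resolution_ode ::
    "nat \<Rightarrow> (nat \<Rightarrow> 'a \<Rightarrow> 'a) \<Rightarrow> real \<Rightarrow> 'a \<Rightarrow> (real \<Rightarrow> 'a::euclidean_space) \<Rightarrow> bool" where
  "solves_resolution_ode r \<Gamma> s X x \<longleftrightarrow>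
     x 0 = X \<and>
     (\<forall>t\<in>{0..sqrt s}.
        (x has_vector_derivative (\<Sum>i\<le>r. sqrt s ^ i *\<^sub>R \<Gamma> i (x t))) (at t within {0..sqrt s}))"

(* Continuity of the coefficients is the regularity implicit in speaking of the solution of the
   ODE: it guarantees solutions on [0, sqrt s] for small s. No uniqueness of solutions is
   presupposed; the o-estimate is required for every choice of solutions.
   Only \<Gamma> 0, ..., \<Gamma> r matter. *)
definition resolution_ode ::
    "nat \<Rightarrow> ('a \<Rightarrow> real \<Rightarrow> 'a) \<Rightarrow> (nat \<Rightarrow> 'a \<Rightarrow> 'a::euclidean_space) \<Rightarrow> bool" where
  "resolution_ode r \<Phi> \<Gamma> \<longleftrightarrow>
     (\<forall>i\<le>r. continuous_on UNIV (\<Gamma> i)) \<and>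
     (\<forall>X. (\<forall>\<^sub>F s in at_right 0. \<exists>x. solves_resolution_ode r \<Gamma> s X x) \<and>
          (\<forall>x. (\<forall>\<^sub>F s in at_right 0. solves_resolution_ode r \<Gamma> s X (x s)) \<longrightarrow>
               (\<lambda>s. norm (x s (sqrt s) - \<Phi> X (sqrt s))) \<in> o[at_right 0](\<lambda>s. sqrt s ^ (r + 1))))"

(* The j-th partial derivative in \<tau> at \<tau> = 0; one-sided there, since \<tau> ranges over {0..}. *)
definition Phi_coeff :: "('a \<Rightarrow> real \<Rightarrow> 'a::euclidean_space) \<Rightarrow> nat \<Rightarrow> 'a \<Rightarrow> 'a" where
  "Phi_coeff \<Phi> j X = ((\<lambda>f \<tau>. vector_derivative f (at \<tau> within {0..})) ^^ j) (\<Phi> X) 0"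

(* The index k starts at 1; the value at k = 0 is never used. *)
fun H_map :: "(nat \<Rightarrow> 'a \<Rightarrow> 'a) \<Rightarrow> nat \<Rightarrow> nat \<Rightarrow> 'a \<Rightarrow> 'a::euclidean_space" where
  "H_map \<Gamma> 0 i = (\<lambda>X. 0)"
| "H_map \<Gamma> (Suc 0) i = \<Gamma> i"
| "H_map \<Gamma> (Suc (Suc k)) i =
     (\<lambda>X. \<Sum>l\<le>i. frechet_derivative (H_map \<Gamma> (Suc k) l) (at X) (\<Gamma> (i - l) X))"

end

theory Submission
  imports Defs
begin

text \<open>Put \<open>h = sqrt s\<close> and \<open>F = \<Sum>i\<le>r. h^i \<Gamma> i\<close>. Along a solution of \<open>x' = F(x)\<close> the \<open>k\<close>-th derivative of \<open>x\<close> is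
  obtained by applying \<open>k - 1\<close> times the operator \<open>G \<mapsto> \<nabla>G F\<close> to \<open>F\<close>, and sorting by powers of \<open>h\<close> gives
  \<open>\<Sum>i. h^i H k i\<close>. Hence \<open>x(h)\<close> and \<open>\<Phi> X h\<close> both have Taylor expansions in \<open>h\<close> of order \<open>r + 1\<close>, whose
  coefficients agree exactly under the recursion for \<open>\<Gamma>\<close>. If \<open>\<Gamma>'\<close> is another resolution ODE and \<open>j\<close>
  is the first index with \<open>\<Gamma>' j \<noteq> \<Gamma> j\<close>, then the two solutions starting at \<open>X\<close> differ at time \<open>h\<close> by
  \<open>h^(j+1) (\<Gamma>' j X - \<Gamma> j X) + o(h^(j+1))\<close>, so the required accuracy forces \<open>\<Gamma>' j X = \<Gamma> j X\<close>; this uses only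
  continuity of \<open>\<Gamma>'\<close>.\<close>

subsection \<open>Functions of class \<open>C\<^sup>n\<close> and Taylor estimates\<close>

lemma C_k_on_SucD: "C_k_on (Suc n) S f \<Longrightarrow> C_k_on n S f"
proof (induction n arbitrary: f)
  case 0
  then show ?case by (auto intro: has_derivative_continuous_on)
next
  case (Suc n)
  from Suc.prems obtain f' where "\<forall>x\<in>S. (f has_derivative f' x) (at x within S)"
    "\<forall>v. C_k_on (Suc n) S (\<lambda>x. f' x v)"
    by (subst (asm) C_k_on.simps(2)) blast
  with Suc.IH show ?case by (subst C_k_on.simps(2)) blast
qed

lemma C_k_on_mono: "C_k_on n S f \<Longrightarrow> m \<le> n \<Longrightarrow> C_k_on m S f"
  by (induction n) (auto simp: le_Suc_eq simp del: C_k_on.simps dest: C_k_on_SucD)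

lemma C_k_on_imp_continuous_on: "C_k_on n S f \<Longrightarrow> continuous_on S f"
  using C_k_on_mono[of n S f 0] by simp

lemma C_k_on_const: "C_k_on n S (\<lambda>x. c)"
proof (induction n arbitrary: c)
  case (Suc n)
  have "(\<forall>x\<in>S. ((\<lambda>x. c) has_derivative (\<lambda>v. 0)) (at x within S)) \<and> (\<forall>v. C_k_on n S (\<lambda>x. 0::'b))"
    using Suc by auto
  then show ?case unfolding C_k_on.simps by (intro exI[of _ "\<lambda>x v. 0"])
qed simp

lemma C_k_on_bounded_linear:
  assumes "bounded_linear T"
  shows "C_k_on n S f \<Longrightarrow> C_k_on n S (\<lambda>x. T (f x))"
proof (induction n arbitrary: f)
  case 0
  then show ?case by (simp add: bounded_linear.continuous_on[OF assms])
next
  case (Suc n)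
  from Suc.prems obtain f' where *: "\<forall>x\<in>S. (f has_derivative f' x) (at x within S)"
    "\<forall>v. C_k_on n S (\<lambda>x. f' x v)"
    by auto
  show ?case unfolding C_k_on.simps
    by (rule exI[of _ "\<lambda>x v. T (f' x v)"])
      (use * Suc.IH bounded_linear.has_derivative[OF assms] in blast)
qed

lemma C_k_on_add:
  "C_k_on n S f \<Longrightarrow> C_k_on n S g \<Longrightarrow> C_k_on n S (\<lambda>x. f x + g x)"
proof (induction n arbitrary: f g)
  case 0
  then show ?case by (simp add: continuous_on_add)
next
  case (Suc n)
  from Suc.prems obtain f' g' where
    "\<forall>x\<in>S. (f has_derivative f' x) (at x within S)" "\<forall>v. C_k_on n S (\<lambda>x. f' x v)"
    "\<forall>x\<in>S. (g has_derivative g' x) (at x within S)" "\<forall>v. C_k_on n S (\<lambda>x. g' x v)"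
    by auto
  with Suc.IH show ?case unfolding C_k_on.simps
    by (intro exI[of _ "\<lambda>x v. f' x v + g' x v"]) (blast intro: has_derivative_add)
qed

lemma C_k_on_sum:
  "(\<And>i. i \<in> I \<Longrightarrow> C_k_on n S (f i)) \<Longrightarrow> C_k_on n S (\<lambda>x. \<Sum>i\<in>I. f i x)"
  by (induction I rule: infinite_finite_induct) (auto intro: C_k_on_add C_k_on_const)

lemma C_k_on_scaleR_const: "C_k_on n S f \<Longrightarrow> C_k_on n S (\<lambda>x. c *\<^sub>R f x)"
  by (rule C_k_on_bounded_linear[OF bounded_linear_scaleR_right])

lemma C_k_on_diff:
  assumes "C_k_on n S f" "C_k_on n S g"
  shows "C_k_on n S (\<lambda>x. f x - g x)"
  using C_k_on_add[OF assms(1) C_k_on_scaleR_const[OF assms(2), of "-1"]] by simp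

lemma C_k_on_scaleR:
  fixes p :: "'a::euclidean_space \<Rightarrow> real"
  shows "C_k_on n S p \<Longrightarrow> C_k_on n S f \<Longrightarrow> C_k_on n S (\<lambda>x. p x *\<^sub>R f x)"
proof (induction n arbitrary: p f)
  case 0
  then show ?case by (simp add: continuous_on_scaleR)
next
  case (Suc n)
  from Suc.prems obtain p' f' where *:
    "\<forall>x\<in>S. (p has_derivative p' x) (at x within S)" "\<forall>v. C_k_on n S (\<lambda>x. p' x v)"
    "\<forall>x\<in>S. (f has_derivative f' x) (at x within S)" "\<forall>v. C_k_on n S (\<lambda>x. f' x v)"
    by auto
  have "C_k_on n S p" "C_k_on n S f"
    using Suc.prems C_k_on_SucD by blast+
  then have "\<forall>v. C_k_on n S (\<lambda>x. p x *\<^sub>R f' x v + p' x v *\<^sub>R f x)"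
    using Suc.IH * C_k_on_add by blast
  with * show ?case unfolding C_k_on.simps
    by (intro exI[of _ "\<lambda>x v. p x *\<^sub>R f' x v + p' x v *\<^sub>R f x"])
      (blast intro: has_derivative_scaleR)
qed

lemma C_k_on_imp_differentiable: "C_k_on (Suc n) UNIV f \<Longrightarrow> f differentiable (at x)"
  by (auto simp: differentiable_def)

text \<open>\<open>C_k_on\<close> controls \<open>f' x v\<close> only for a fixed direction
  \<open>v\<close>. Expanding the moving direction \<open>g x\<close> in \<open>Basis\<close> leaves
  scalar functions times such terms.\<close>

lemma C_k_on_frechet_derivative:
  assumes "C_k_on (Suc n) UNIV f" and "C_k_on n UNIV g"
  shows "C_k_on n UNIV (\<lambda>x. frechet_derivative f (at x) (g x))"
proof -
  from assms(1) obtain f' where f': "\<And>x. (f has_derivative f' x) (at x)"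
    "\<And>v. C_k_on n UNIV (\<lambda>x. f' x v)"
    by auto
  have "frechet_derivative f (at x) (g x) = (\<Sum>b\<in>Basis. (g x \<bullet> b) *\<^sub>R f' x b)" for x
  proof -
    have lin: "linear (f' x)"
      using f'(1) has_derivative_linear by blast
    have "frechet_derivative f (at x) (g x) = f' x (\<Sum>b\<in>Basis. (g x \<bullet> b) *\<^sub>R b)"
      using frechet_derivative_at[OF f'(1)] by (simp add: euclidean_representation)
    also have "\<dots> = (\<Sum>b\<in>Basis. (g x \<bullet> b) *\<^sub>R f' x b)"
      by (simp add: linear_sum[OF lin] linear_cmul[OF lin])
    finally show ?thesis .
  qed
  moreover have "C_k_on n UNIV (\<lambda>x. \<Sum>b\<in>Basis. (g x \<bullet> b) *\<^sub>R f' x b)"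
    by (intro C_k_on_sum C_k_on_scaleR C_k_on_bounded_linear[OF bounded_linear_inner_left] f' assms(2))
  ultimately show ?thesis by simp
qed

text \<open>Derivatives on the half space are one-sided at its boundary, but X \<mapsto> (X, 0)
  stays inside it, so the chain rule yields a full derivative in X. This carries the smoothness of
  the template over to its coefficients at \<tau> = 0.\<close>

lemma C_k_on_slice:
  "C_k_on n (UNIV \<times> {0..}) F \<Longrightarrow> C_k_on n UNIV (\<lambda>X. F (X, 0::real))"
proof (induction n arbitrary: F)
  case 0
  then show ?case
    by (auto intro!: continuous_on_compose2[of "UNIV \<times> {0..}" F] continuous_intros)
next
  case (Suc n)
  from Suc.prems obtain F' where F':
    "\<And>z. z \<in> UNIV \<times> {0..} \<Longrightarrow> (F has_derivative F' z) (at z within UNIV \<times> {0..})"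
    "\<And>v. C_k_on n (UNIV \<times> {0..}) (\<lambda>z. F' z v)"
    by auto
  have "((\<lambda>X. F (X, 0)) has_derivative (\<lambda>v. F' (X, 0) (v, 0))) (at X)" for X
    by (rule has_derivative_in_compose2[of "UNIV \<times> {0..}" F F' "\<lambda>X. (X, 0)"])
      (auto intro: F' has_derivative_Pair[OF has_derivative_ident has_derivative_const])
  moreover have "C_k_on n UNIV (\<lambda>X. F' (X, 0) (v, 0))" for v
    using Suc.IH[OF F'(2)] by simp
  ultimately show ?case unfolding C_k_on.simps
    by (intro exI[of _ "\<lambda>X v. F' (X, 0) (v, 0)"]) blast
qed

section \<open>Local Lipschitz, mean value and Taylor estimates\<close>

lemma C_k_on_imp_local_lipschitz:
  fixes f :: "'a::euclidean_space \<Rightarrow> 'b::euclidean_space"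
  assumes "C_k_on (Suc n) UNIV f"
  obtains L where "L \<ge> 0"
    "\<And>a b. a \<in> cball X e \<Longrightarrow> b \<in> cball X e \<Longrightarrow> norm (f a - f b) \<le> L * norm (a - b)"
proof -
  from assms obtain f' where f': "\<And>x. (f has_derivative f' x) (at x)"
    "\<And>v. C_k_on n UNIV (\<lambda>x. f' x v)"
    by auto
  \<comment> \<open>This sum dominates the operator norm of \<open>f' x\<close> and is continuous by
    the directionwise form of \<open>C_k_on\<close>, so compactness of the ball supplies
    \<open>L\<close>.\<close>
  have "continuous_on (cball X e) (\<lambda>x. \<Sum>b\<in>Basis. norm (f' x b))"
    by (intro continuous_intros continuous_on_subset[OF C_k_on_imp_continuous_on[OF f'(2)]]) simp
  then have "bounded ((\<lambda>x. \<Sum>b\<in>Basis. norm (f' x b)) ` cball X e)"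
    by (intro compact_imp_bounded compact_continuous_image) auto
  then obtain L where L: "L > 0" "\<And>x. x \<in> cball X e \<Longrightarrow> (\<Sum>b\<in>Basis. norm (f' x b)) \<le> L"
    unfolding bounded_pos by (auto simp: abs_le_iff)
  have "norm (f a - f b) \<le> L * norm (a - b)" if "a \<in> cball X e" "b \<in> cball X e" for a b
    using that
    by (intro differentiable_bound[of "cball X e" f f'])
      (auto intro!: has_derivative_at_withinI f' order_trans[OF onorm_componentwise L(2)]
        has_derivative_bounded_linear[OF f'(1)])
  with L(1) show thesis by (intro that[of L]) auto
qed

text \<open>The bound is asked only at interior times before \<open>u\<close>, which is what a first
  exit argument can provide.\<close>

lemma mean_value_bound:
  fixes f :: "real \<Rightarrow> 'a::euclidean_space"
  assumes der: "\<And>t. t \<in> {0..h} \<Longrightarrow> (f has_vector_derivative f' t) (at t within {0..h})"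
    and u: "u \<in> {0..h}"
    and bound: "\<And>t. 0 < t \<Longrightarrow> t < u \<Longrightarrow> norm (f' t) \<le> B"
  shows "norm (f u - f 0) \<le> B * u"
proof (cases "u = 0")
  case False
  have "continuous_on {0..h} f"
    using der by (rule continuous_on_vector_derivative)
  then have cont: "continuous_on {0..u} f"
    by (rule continuous_on_subset) (use u in auto)
  obtain t where t: "t \<in> {0<..<u}" "norm (f u - f 0) \<le> norm ((\<lambda>v. v *\<^sub>R f' t) (u - 0))"
  proof (rule mvt_general[of 0 u f "\<lambda>t v. v *\<^sub>R f' t", THEN bexE])
    show "(f has_derivative (\<lambda>v. v *\<^sub>R f' t)) (at t)" if "0 < t" "t < u" for t
      using der[of t] that u by (simp add: has_vector_derivative_def at_within_Icc_at)
  qed (use u False cont in auto)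
  then have "norm (f u - f 0) \<le> u * norm (f' t)" using u by simp
  also have "\<dots> \<le> u * B" using t u bound by (intro mult_left_mono) auto
  finally show ?thesis by (simp add: mult.commute)
qed simp

text \<open>Differentiating the error gives the error of the shifted family one order lower, so the
  induction hypothesis integrates up. The remainder is measured by the oscillation of the
  \<open>n\<close>-th derivative, as suits an o-type estimate; the factor 1/n! is given
  away.\<close>

lemma taylor_remainder_bound:
  fixes f :: "nat \<Rightarrow> real \<Rightarrow> 'a::euclidean_space"
  assumes "\<And>k t. k < n \<Longrightarrow> t \<in> {0..h} \<Longrightarrow>
      (f k has_vector_derivative f (Suc k) t) (at t within {0..h})"
    and "\<And>t. t \<in> {0..h} \<Longrightarrow> norm (f n t - f n 0) \<le> e"
    and "u \<in> {0..h}"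
  shows "norm (f 0 u - (\<Sum>k\<le>n. (u ^ k / fact k) *\<^sub>R f k 0)) \<le> e * u ^ n"
  using assms
proof (induction n arbitrary: f u)
  case (Suc n)
  define E where "E t = f 0 t - (\<Sum>k\<le>Suc n. (t ^ k / fact k) *\<^sub>R f k 0)" for t
  define E' where "E' t = f (Suc 0) t - (\<Sum>k\<le>n. (t ^ k / fact k) *\<^sub>R f (Suc k) 0)" for t
  have e: "e \<ge> 0"
    using Suc.prems(2)[OF Suc.prems(3)] norm_ge_zero order_trans by blast
  have bound: "norm (E' t) \<le> e * t ^ n" if "t \<in> {0..h}" for t
    unfolding E'_def using Suc.IH[of "\<lambda>k. f (Suc k)" t] Suc.prems that by simp
  have E: "E t = f 0 t - f 0 0 - (\<Sum>k\<le>n. (t ^ Suc k / fact (Suc k)) *\<^sub>R f (Suc k) 0)" for t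
    unfolding E_def by (subst sum.atMost_Suc_shift) simp
  have der: "(E has_vector_derivative E' t) (at t within {0..h})" if t: "t \<in> {0..h}" for t
  proof -
    have 1: "((\<lambda>t. (t ^ Suc k / fact (Suc k)) *\<^sub>R f (Suc k) 0) has_vector_derivative
            (t ^ k / fact k) *\<^sub>R f (Suc k) 0) (at t within {0..h})" for k
    proof -
      have "((\<lambda>t::real. t ^ Suc k / fact (Suc k)) has_real_derivative t ^ k / fact k) (at t within {0..h})"
        by (intro DERIV_cdivide[OF DERIV_pow, THEN DERIV_cong]) (simp add: fact_Suc field_simps del: of_nat_Suc)
      then show ?thesis
        unfolding has_real_derivative_iff_has_vector_derivative
        by (rule bounded_linear.has_vector_derivative[OF bounded_linear_scaleR_left])
    qed
    show ?thesis
      unfolding E E'_def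
      using has_vector_derivative_diff[OF has_vector_derivative_diff[OF
          Suc.prems(1)[of 0 t] has_vector_derivative_const[of "f 0 0"]]
          has_vector_derivative_sum[of "{..n}", OF 1]] t by simp
  qed
  have "norm (E u - E 0) \<le> e * u ^ n * u"
  proof (rule mean_value_bound[OF der Suc.prems(3)])
    fix t :: real assume t: "0 < t" "t < u"
    then have "norm (E' t) \<le> e * t ^ n" using Suc.prems(3) bound by auto
    also have "\<dots> \<le> e * u ^ n" using t e by (intro mult_left_mono power_mono) auto
    finally show "norm (E' t) \<le> e * u ^ n" .
  qed
  moreover have "E 0 = 0" by (simp add: E)
  ultimately show ?case by (simp add: E_def mult_ac)
qed simp

subsection \<open>Coefficients\<close>

lemma C_k_on_partial_snd:
  assumes "C_k_on N (UNIV \<times> {0..}) F"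
  obtains D :: "nat \<Rightarrow> 'a::euclidean_space \<times> real \<Rightarrow> 'b::euclidean_space"
  where "D 0 = F" "\<And>j. j \<le> N \<Longrightarrow> C_k_on (N - j) (UNIV \<times> {0..}) (D j)"
    "\<And>j X t. j < N \<Longrightarrow> 0 \<le> t \<Longrightarrow>
      ((\<lambda>t. D j (X, t)) has_vector_derivative D (Suc j) (X, t)) (at t within {0..})"
proof -
  let ?S = "UNIV \<times> {0..} :: ('a \<times> real) set"
  have "\<exists>D. D 0 = F \<and> (\<forall>j\<le>N. C_k_on (N - j) ?S (D j)) \<and>
    (\<forall>j<N. \<forall>X. \<forall>t\<ge>0.
      ((\<lambda>t. D j (X, t)) has_vector_derivative D (Suc j) (X, t)) (at t within {0..}))"
    using assms
  proof (induction N arbitrary: F)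
    case 0
    then show ?case by (intro exI[of _ "\<lambda>_. F"]) simp
  next
    case (Suc N)
    from Suc.prems obtain F' where F': "\<And>z. z \<in> ?S \<Longrightarrow> (F has_derivative F' z) (at z within ?S)"
      "\<And>v. C_k_on N ?S (\<lambda>z. F' z v)"
      by auto
    \<comment> \<open>The \<tau>-derivative of \<open>F\<close> is \<open>F' z\<close> in direction
      \<open>(0, 1)\<close>; \<open>case_nat\<close> below puts \<open>F\<close> in front of the
      chain obtained for it.\<close>
    from Suc.IH[OF F'(2)[of "(0, 1)"]] obtain D where D: "D 0 = (\<lambda>z. F' z (0, 1))"
      "\<forall>j\<le>N. C_k_on (N - j) ?S (D j)"
      "\<forall>j<N. \<forall>X. \<forall>t\<ge>0.
        ((\<lambda>t. D j (X, t)) has_vector_derivative D (Suc j) (X, t)) (at t within {0..})"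
      by auto
    have "((\<lambda>t. F (X, t)) has_vector_derivative F' (X, t) (0, 1)) (at t within {0..})"
      if "0 \<le> t" for X t
    proof -
      have pair: "((\<lambda>t. (X, t)) has_derivative (\<lambda>v. (0, v))) (at t within {0..})"
        by (rule has_derivative_Pair[OF has_derivative_const has_derivative_ident])
      have "((\<lambda>t. F (X, t)) has_derivative (\<lambda>v. F' (X, t) (0, v))) (at t within {0..})"
        by (rule has_derivative_in_compose2[where s = "{0..}", OF F'(1) _ _ pair])
          (use that in blast)+
      moreover have "F' (X, t) (0, v) = v *\<^sub>R F' (X, t) (0, 1)" for v
      proof -
        have "F' (X, t) (0, v) = F' (X, t) (v *\<^sub>R (0, 1))" by simp
        also have "\<dots> = v *\<^sub>R F' (X, t) (0, 1)"
          by (rule linear_cmul[OF has_derivative_linear[OF F'(1)]]) (use that in blast)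
        finally show ?thesis .
      qed
      then have "(\<lambda>v. F' (X, t) (0, v)) = (\<lambda>v. v *\<^sub>R F' (X, t) (0, 1))" ..
      ultimately show ?thesis by (simp only: has_vector_derivative_def)
    qed
    then have der: "((\<lambda>t. case_nat F D j (X, t)) has_vector_derivative case_nat F D (Suc j) (X, t))
        (at t within {0..})" if "j < Suc N" "0 \<le> t" for j X t
      using that D(1,3) by (cases j) simp_all
    have smooth: "C_k_on (Suc N - j) ?S (case_nat F D j)" if "j \<le> Suc N" for j
    proof (cases j)
      case 0
      then show ?thesis using Suc.prems by (simp only: nat.case diff_zero)
    next
      case (Suc j')
      then show ?thesis using D(2) that by simp
    qed
    show ?case
      by (intro exI[of _ "case_nat F D"] conjI allI impI der smooth) simp_all
  qed
  then obtain D where "D 0 = F \<and> (\<forall>j\<le>N. C_k_on (N - j) ?S (D j)) \<and>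
    (\<forall>j<N. \<forall>X. \<forall>t\<ge>0.
      ((\<lambda>t. D j (X, t)) has_vector_derivative D (Suc j) (X, t)) (at t within {0..}))" ..
  then show thesis by (intro that[of D]) simp_all
qed

text \<open>The iterated derivative is identified at all \<open>t \<ge> 0\<close>, since each
  further differentiation at 0 needs the previous function nearby. Every such \<open>t\<close> is a
  limit point of the half line, so the one-sided derivative is unique.\<close>

lemma Phi_coeff_eq:
  assumes D0: "D 0 = (\<lambda>(X, t). \<Phi> X t)"
    and D: "\<And>j X t. j < N \<Longrightarrow> 0 \<le> t \<Longrightarrow>
      ((\<lambda>t. D j (X, t)) has_vector_derivative D (Suc j) (X, t)) (at t within {0..})"
    and "j \<le> N"
  shows "Phi_coeff \<Phi> j X = D j (X, 0)"
proof -
  have "((\<lambda>f t. vector_derivative f (at t within {0..})) ^^ j) (\<Phi> X) t = D j (X, t)" if "0 \<le> t" for t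
    using that \<open>j \<le> N\<close>
  proof (induction j arbitrary: t)
    case 0
    then show ?case by (simp add: D0)
  next
    case (Suc j)
    define G where "G = ((\<lambda>f t. vector_derivative f (at t within {0..})) ^^ j) (\<Phi> X)"
    have "(G has_vector_derivative D (Suc j) (X, t)) (at t within {0..})"
      by (rule has_vector_derivative_transform[OF _ _ D]) (use Suc G_def in auto)
    moreover have "at t within {0..} \<noteq> bot"
      using islimpt_subset[OF islimpt_greaterThanLessThan1, of t "t + 1" "{0..}"] Suc.prems(1)
      by (force simp: trivial_limit_within)
    ultimately have "vector_derivative G (at t within {0..}) = D (Suc j) (X, t)"
      by (intro vector_derivative_within)
    then show ?case by (simp add: G_def)
  qed
  then show ?thesis by (simp add: Phi_coeff_def)
qed

text \<open>A count of derivatives: \<open>w i\<close> bounds those already consumed by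
  \<open>\<Gamma> i\<close>, and each \<nabla> in the recursion costs one more. Monotonicity of
  \<open>w\<close> lets the factors with indices \<open>l\<close> and \<open>i - l\<close> both be
  charged at \<open>w i\<close>.\<close>

lemma C_k_on_H_map:
  assumes mono: "mono w"
    and smooth: "\<And>i m. m + w i < N \<Longrightarrow> C_k_on m UNIV (\<Gamma> i)"
    and "m + k + w i \<le> N" "k > 0"
  shows "C_k_on m UNIV (H_map \<Gamma> k i)"
  using assms(3,4)
proof (induction k arbitrary: m i)
  case (Suc k)
  show ?case
  proof (cases k)
    case 0
    then show ?thesis using Suc.prems smooth by simp
  next
    case (Suc k')
    have "C_k_on m UNIV (\<lambda>X. frechet_derivative (H_map \<Gamma> k l) (at X) (\<Gamma> (i - l) X))"
      if l: "l \<le> i" for l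
    proof (rule C_k_on_frechet_derivative)
      have "w l \<le> w i" "w (i - l) \<le> w i"
        using l by (auto intro!: monoD[OF mono])
      then have "Suc m + k + w l \<le> N" "0 < k" "m + w (i - l) < N"
        using Suc.prems Suc by linarith+
      then show "C_k_on (Suc m) UNIV (H_map \<Gamma> k l)" "C_k_on m UNIV (\<Gamma> (i - l))"
        using Suc.IH[of "Suc m" l] smooth[of m "i - l"] by blast+
    qed
    then have "C_k_on m UNIV (\<lambda>X. \<Sum>l\<le>i. frechet_derivative (H_map \<Gamma> k l) (at X) (\<Gamma> (i - l) X))"
      by (intro C_k_on_sum) (simp only: atMost_iff)
    then show ?thesis by (simp only: Suc H_map.simps)
  qed
qed simp

lemma H_map_cong:
  assumes "\<And>i. i \<le> n \<Longrightarrow> \<Gamma> i = \<Gamma>' i" "i \<le> n"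
  shows "H_map \<Gamma> k i = H_map \<Gamma>' k i"
  using assms
proof (induction \<Gamma> k i rule: H_map.induct)
  case (3 \<Gamma> k i)
  then have "H_map \<Gamma> (Suc k) l = H_map \<Gamma>' (Suc k) l" if "l \<le> i" for l
    using that by simp
  with 3 show ?case by simp
qed auto

text \<open>\<open>H_map \<Gamma> k i\<close> is the coefficient of \<open>h^i\<close> in a
  polynomial of degree at most \<open>k * r\<close> in \<open>h\<close>. In the induction step
  either \<open>l > k * r\<close> kills the first factor or \<open>i - l > r\<close> the second;
  differentiability makes \<open>frechet_derivative\<close> linear, hence 0 at 0.\<close>

lemma H_map_eq_0:
  assumes zero: "\<And>i. r < i \<Longrightarrow> \<Gamma> i = (\<lambda>X. 0)"
    and "\<And>j l X. 0 < j \<Longrightarrow> j < k \<Longrightarrow> H_map \<Gamma> j l differentiable (at X)"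
    and "k * r < i"
  shows "H_map \<Gamma> k i = (\<lambda>X. 0)"
  using assms(2,3)
proof (induction k arbitrary: i)
  case (Suc k)
  show ?case
  proof (cases k)
    case 0
    then show ?thesis using Suc.prems zero by simp
  next
    case (Suc k')
    have "frechet_derivative (H_map \<Gamma> k l) (at X) (\<Gamma> (i - l) X) = 0" if "l \<le> i" for l X
    proof (cases "k * r < l")
      case True
      then have "H_map \<Gamma> k l = (\<lambda>X. 0)"
        using Suc.IH Suc.prems(1) by simp
      then show ?thesis by simp
    next
      case False
      then have "\<Gamma> (i - l) X = 0" using Suc.prems(2) zero[of "i - l"] by simp
      moreover have "linear (frechet_derivative (H_map \<Gamma> k l) (at X))"
        using Suc.prems(1) Suc by (intro linear_frechet_derivative) simp
      ultimately show ?thesis by (simp add: linear_0)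
    qed
    then show ?thesis by (simp add: Suc)
  qed
qed simp

section \<open>Construction and regularity of the coefficients\<close>

definition gamma_formula :: "('a \<Rightarrow> real \<Rightarrow> 'a) \<Rightarrow> (nat \<Rightarrow> 'a \<Rightarrow> 'a) \<Rightarrow> nat \<Rightarrow> 'a \<Rightarrow> 'a::euclidean_space" where
  "gamma_formula \<Phi> \<Gamma> j X = (1 / fact (j + 1)) *\<^sub>R Phi_coeff \<Phi> (j + 1) X
     - (\<Sum>k=2..j+1. (1 / fact k) *\<^sub>R H_map \<Gamma> k (j + 1 - k) X)"

text \<open>The formula for \<open>\<Gamma> j\<close> involves only \<open>\<Gamma> i\<close> with \<open>i < j\<close>, so the coefficients can be filled in one at a
  time; those not yet defined are \<open>0\<close>.\<close>

primrec gamma_upto :: "('a \<Rightarrow> real \<Rightarrow> 'a) \<Rightarrow> nat \<Rightarrow> nat \<Rightarrow> 'a \<Rightarrow> 'a::euclidean_space" where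
  "gamma_upto \<Phi> 0 = (\<lambda>i X. 0)"
| "gamma_upto \<Phi> (Suc n) = (gamma_upto \<Phi> n)(n := gamma_formula \<Phi> (gamma_upto \<Phi> n) n)"

lemma gamma_upto_eq_0: "n \<le> i \<Longrightarrow> gamma_upto \<Phi> n i = (\<lambda>X. 0)"
  by (induction n) auto

lemma gamma_upto_eq: "i < n \<Longrightarrow> gamma_upto \<Phi> n i = gamma_formula \<Phi> (gamma_upto \<Phi> n) i"
proof (induction n)
  case (Suc n)
  have "gamma_formula \<Phi> (gamma_upto \<Phi> (Suc n)) i = gamma_formula \<Phi> (gamma_upto \<Phi> n) i"
  proof -
    \<comment> \<open>As \<open>k \<ge> 2\<close>, only coefficients of index at most
      \<open>i - 1 < n\<close> occur, so overwriting index \<open>n\<close> changes nothing.\<close>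
    have "H_map (gamma_upto \<Phi> (Suc n)) k (i + 1 - k) = H_map (gamma_upto \<Phi> n) k (i + 1 - k)"
      if "k \<in> {2..i + 1}" for k
      using Suc.prems that by (intro H_map_cong[of "i - 1"]) auto
    then show ?thesis
      unfolding gamma_formula_def by (intro ext arg_cong2[where f = "(-)"] sum.cong) auto
  qed
  then show ?case using Suc by (auto simp: less_Suc_eq simp del: gamma_upto.simps) simp_all
qed simp

text \<open>The cap \<open>min i r\<close> covers the indices \<open>i > r\<close>, where the coefficient is \<open>0\<close> but \<open>H_map\<close> need not be.\<close>

lemma C_k_on_gamma_upto:
  assumes Phi: "\<And>j. j \<le> 2 * r + 2 \<Longrightarrow> C_k_on (2 * r + 2 - j) UNIV (Phi_coeff \<Phi> j)"
    and "n \<le> Suc r" "m + min i r < 2 * r + 2"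
  shows "C_k_on m UNIV (gamma_upto \<Phi> n i)"
  using assms(2,3)
proof (induction n arbitrary: m i)
  case (Suc n)
  show ?case
  proof (cases "i = n")
    case True
    have "C_k_on m UNIV (H_map (gamma_upto \<Phi> n) k (n + 1 - k))" if "k \<in> {2..n+1}" for k
      by (rule C_k_on_H_map[where w = "\<lambda>i. min i r" and N = "2 * r + 2"])
        (use Suc that True in \<open>auto intro!: monoI\<close>)
    moreover have "C_k_on m UNIV (Phi_coeff \<Phi> (n + 1))"
      using Suc.prems True by (intro C_k_on_mono[OF Phi]) auto
    ultimately show ?thesis
      unfolding gamma_upto.simps True fun_upd_same gamma_formula_def
      by (intro C_k_on_diff C_k_on_sum C_k_on_scaleR_const)
  next
    case False
    then show ?thesis using Suc by simp
  qed
qed (simp add: C_k_on_const)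

subsection \<open>Initial value problems on short intervals\<close>

definition solves_ivp :: "('a::euclidean_space \<Rightarrow> 'a) \<Rightarrow> real \<Rightarrow> 'a \<Rightarrow> (real \<Rightarrow> 'a) \<Rightarrow> bool" where
  "solves_ivp F h X x \<longleftrightarrow>
     x 0 = X \<and> (\<forall>t\<in>{0..h}. (x has_vector_derivative F (x t)) (at t within {0..h}))"

text \<open>Up to its first exit time the solution has speed at most \<open>M\<close>, so it covers
  a distance of at most \<open>M * h < d\<close> and cannot have reached the sphere.\<close>

lemma solves_ivp_in_cball:
  assumes x: "solves_ivp F h X x" and bound: "\<And>y. y \<in> cball X d \<Longrightarrow> norm (F y) \<le> M"
    and "d > 0" "M * h < d" and t: "t \<in> {0..h}"
  shows "x t \<in> cball X d"
proof (rule ccontr)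
  assume out: "x t \<notin> cball X d"
  have der: "(x has_vector_derivative F (x t)) (at t within {0..h})" if "t \<in> {0..h}" for t
    using x that by (simp add: solves_ivp_def)
  have x0: "x 0 = X" using x by (simp add: solves_ivp_def)
  have cont: "continuous_on {0..h} x"
    using der by (rule continuous_on_vector_derivative)
  \<comment> \<open>Leaving is measured by the open ball: this makes \<open>C\<close> compact, so
    that it has a least element, the first exit time.\<close>
  define C where "C = {0..h} \<inter> x -` (- ball X d)"
  have "closed C"
    unfolding C_def by (rule continuous_closed_preimage[OF cont]) auto
  then have "compact C"
    using compact_Int_closed[of "{0..h}" C] by (simp add: C_def Int_absorb2 inf.coboundedI1)
  moreover have "t \<in> C"
    using t out by (auto simp: C_def)
  ultimately obtain u where u: "u \<in> C" "\<And>v. v \<in> C \<Longrightarrow> u \<le> v"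
    using compact_attains_inf[of C] by blast
  have "norm (x u - x 0) \<le> M * u"
  proof (rule mean_value_bound[OF der])
    show "norm (F (x v)) \<le> M" if "0 < v" "v < u" for v
    proof (rule bound)
      have "v \<notin> C" using u(2)[of v] that by auto
      then show "x v \<in> cball X d" using that u(1) by (auto simp: C_def)
    qed
  qed (use u(1) in \<open>auto simp: C_def\<close>)
  also have "M * u \<le> M * h"
    using u(1) bound[of X] \<open>d > 0\<close> by (intro mult_left_mono) (auto simp: C_def intro: order_trans[OF norm_ge_zero])
  also have "\<dots> < d" by fact
  finally show False
    using u(1) x0 by (auto simp: C_def dist_norm norm_minus_commute)
qed

text \<open>Composing the vector field with the projection onto the ball makes the Picard operator a
  contraction of the whole space of bounded continuous functions.\<close>

lemma solves_ivp_exists: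
  fixes F :: "'a::euclidean_space \<Rightarrow> 'a"
  assumes "d > 0" "h \<ge> 0" "L \<ge> 0"
    and lipschitz: "\<And>a b. a \<in> cball X d \<Longrightarrow> b \<in> cball X d \<Longrightarrow> norm (F a - F b) \<le> L * norm (a - b)"
    and bound: "\<And>y. y \<in> cball X d \<Longrightarrow> norm (F y) \<le> M"
    and "M * h < d" "L * h < 1"
  shows "\<exists>x. solves_ivp F h X x"
proof -
  define p where "p = closest_point (cball X d)"
  define G where "G y = F (p y)" for y
  have p: "p y \<in> cball X d" for y
    unfolding p_def using \<open>d > 0\<close> by (intro closest_point_in_set) auto
  have p_self: "p y = y" if "y \<in> cball X d" for y
    unfolding p_def using that by (rule closest_point_self)
  have G_lip: "dist (G a) (G b) \<le> L * dist a b" for a b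
  proof -
    have "dist (G a) (G b) \<le> L * dist (p a) (p b)"
      using lipschitz[OF p p] by (simp add: G_def dist_norm)
    also have "\<dots> \<le> L * dist a b"
      unfolding p_def using \<open>d > 0\<close> \<open>L \<ge> 0\<close>
      by (intro mult_left_mono closest_point_lipschitz) auto
    finally show ?thesis .
  qed
  have G_bound: "norm (G y) \<le> M" for y
    using bound[OF p] by (simp add: G_def)
  have G_cont: "continuous_on UNIV G"
    using G_lip \<open>L \<ge> 0\<close> by (intro lipschitz_on_continuous_on[of L] lipschitz_onI) auto
  have Gf_cont: "continuous_on S (\<lambda>u. G (apply_bcontfun f u))" for f :: "real \<Rightarrow>\<^sub>C 'a" and S
    by (rule continuous_on_compose2[OF G_cont]) auto
  \<comment> \<open>Clamping time to \<open>{0..h}\<close> lets the Picard operator act on bounded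
    continuous functions on the whole real line.\<close>
  define c where "c t = max 0 (min h t)" for t
  have c: "0 \<le> c t" "c t \<le> h" for t
    using \<open>h \<ge> 0\<close> by (auto simp: c_def)
  define P where "P f t = X + integral {0..c t} (\<lambda>u. G (apply_bcontfun f u))" for f t
  have P_bcontfun: "P f \<in> bcontfun" for f
  proof (rule bcontfun_normI)
    have "continuous_on {0..h} (\<lambda>t. integral {0..t} (\<lambda>u. G (apply_bcontfun f u)))"
      by (intro indefinite_integral_continuous_1 integrable_continuous_real Gf_cont)
    then have "continuous_on UNIV (\<lambda>t. integral {0..c t} (\<lambda>u. G (apply_bcontfun f u)))"
      by (rule continuous_on_compose2) (use c in \<open>auto simp: c_def intro!: continuous_intros\<close>)
    then show "continuous_on UNIV (P f)"
      unfolding P_def by (intro continuous_intros)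
    show "norm (P f t) \<le> norm X + M * h" for t
    proof -
      have "norm (integral {0..c t} (\<lambda>u. G (apply_bcontfun f u))) \<le> M * (c t - 0)"
        by (rule integral_bound) (use c Gf_cont G_bound in auto)
      also have "\<dots> \<le> M * h"
        using c G_bound[of 0] by (intro mult_mono) (auto intro: order_trans[OF norm_ge_zero])
      finally show ?thesis
        unfolding P_def by (intro order_trans[OF norm_triangle_ineq] add_left_mono)
    qed
  qed
  have "dist (Bcontfun (P f)) (Bcontfun (P g)) \<le> (L * h) * dist f g" for f g
  proof (rule dist_bound)
    fix t
    let ?I = "\<lambda>f. integral {0..c t} (\<lambda>u. G (apply_bcontfun f u))"
    have "dist (P f t) (P g t) = norm (integral {0..c t} (\<lambda>u. G (apply_bcontfun f u) - G (apply_bcontfun g u)))"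
      by (subst integral_diff) (auto simp: P_def dist_norm intro!: integrable_continuous_real Gf_cont)
    also have "\<dots> \<le> (L * dist f g) * (c t - 0)"
    proof (rule integral_bound)
      show "norm (G (apply_bcontfun f u) - G (apply_bcontfun g u)) \<le> L * dist f g" for u
        using G_lip[of "apply_bcontfun f u" "apply_bcontfun g u"]
          mult_left_mono[OF dist_bounded[of f u g] \<open>L \<ge> 0\<close>]
        by (simp add: dist_norm)
    qed (use c in \<open>auto intro!: continuous_intros Gf_cont\<close>)
    also have "\<dots> \<le> (L * dist f g) * h"
      using c \<open>L \<ge> 0\<close> by (intro mult_left_mono) auto
    finally show "dist (apply_bcontfun (Bcontfun (P f)) t) (apply_bcontfun (Bcontfun (P g)) t)
        \<le> L * h * dist f g"
      using P_bcontfun by (simp add: Bcontfun_inverse mult_ac)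
  qed
  then have "\<exists>!f. Bcontfun (P f) = f"
    using assms by (intro banach_fix_type) auto
  then obtain f where "Bcontfun (P f) = f" by blast
  then have f: "apply_bcontfun f t = P f t" for t
    using P_bcontfun by (metis Bcontfun_inverse)
  let ?x = "apply_bcontfun f"
  have x0: "?x 0 = X"
    using \<open>h \<ge> 0\<close> f[of 0] by (simp add: P_def c_def)
  have der: "(?x has_vector_derivative G (?x t)) (at t within {0..h})" if t: "t \<in> {0..h}" for t
  proof -
    have int: "((\<lambda>t. X + integral {0..t} (\<lambda>u. G (?x u))) has_vector_derivative 0 + G (?x t)) (at t within {0..h})"
      by (intro has_vector_derivative_add has_vector_derivative_const
          integral_has_vector_derivative Gf_cont t)
    have eq: "?x u = X + integral {0..u} (\<lambda>u. G (?x u))" if "u \<in> {0..h}" for u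
    proof -
      have "c u = u" using that by (simp add: c_def)
      then show ?thesis using f[of u] by (simp only: P_def)
    qed
    show ?thesis
      using has_vector_derivative_transform[OF t eq int] by simp
  qed
  have G: "solves_ivp G h X ?x"
    using x0 der by (simp add: solves_ivp_def)
  \<comment> \<open>The confinement lemma applies to \<open>G\<close>, which is bounded by
    \<open>M\<close> everywhere. Inside the ball the projection is the identity, so the solution for
    \<open>G\<close> is one for \<open>F\<close>.\<close>
  have "?x t \<in> cball X d" if "t \<in> {0..h}" for t
    by (rule solves_ivp_in_cball[OF G G_bound]) (use that assms in auto)
  then have "G (?x t) = F (?x t)" if "t \<in> {0..h}" for t
    using that by (simp add: G_def p_self)
  with G have "solves_ivp F h X ?x"
    by (simp add: solves_ivp_def)
  then show ?thesis by blast
qed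

section \<open>The field of the resolution ODE, with estimates uniform in \<open>h\<close>\<close>

definition resolution_field :: "nat \<Rightarrow> (nat \<Rightarrow> 'a \<Rightarrow> 'a) \<Rightarrow> real \<Rightarrow> 'a \<Rightarrow> 'a::euclidean_space" where
  "resolution_field r \<Gamma> h y = (\<Sum>i\<le>r. h ^ i *\<^sub>R \<Gamma> i y)"

lemma solves_resolution_ode_iff:
  "solves_resolution_ode r \<Gamma> s X x \<longleftrightarrow> solves_ivp (resolution_field r \<Gamma> (sqrt s)) (sqrt s) X x"
  by (simp add: solves_resolution_ode_def solves_ivp_def resolution_field_def)

lemma eventually_at_right_0_small:
  fixes c d :: real
  assumes "d > 0"
  shows "\<forall>\<^sub>F h in at_right 0. c * h < d"
proof -
  have "((\<lambda>h. c * h) \<longlongrightarrow> c * 0) (at_right 0)"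
    by (intro tendsto_intros)
  then show ?thesis using assms by (intro order_tendstoD(2)) auto
qed

lemma eventually_at_right_0_unit: "\<forall>\<^sub>F h in at_right (0::real). 0 < h \<and> h \<le> 1"
  by (auto simp: eventually_at_right_field intro: exI[of _ 1])

text \<open>\<open>h\<close> is a parameter of the field and also the length of the time interval.
  Compactness of \<open>{0..1} \<times> cball X d\<close> gives one \<open>M\<close> for all these
  \<open>h\<close>, so \<open>M * h < d\<close> can be reached by shrinking
  \<open>h\<close>.\<close>

lemma resolution_field_bounded:
  assumes "\<And>i. i \<le> r \<Longrightarrow> continuous_on UNIV (\<Gamma> i)"
  obtains M where "\<And>h y. h \<in> {0..1} \<Longrightarrow> y \<in> cball X d \<Longrightarrow> norm (resolution_field r \<Gamma> h y) \<le> M"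
proof -
  have "continuous_on ({0..1} \<times> cball X d) (\<lambda>z. resolution_field r \<Gamma> (fst z) (snd z))"
    unfolding resolution_field_def
    by (intro continuous_intros continuous_on_compose2[OF assms]) auto
  then have "bounded ((\<lambda>z. resolution_field r \<Gamma> (fst z) (snd z)) ` ({0..1} \<times> cball X d))"
    by (intro compact_imp_bounded compact_continuous_image compact_Times) auto
  then obtain M where "\<forall>z\<in>{0..1} \<times> cball X d. norm (resolution_field r \<Gamma> (fst z) (snd z)) \<le> M"
    unfolding bounded_iff by auto
  then show thesis by (intro that[of M]) auto
qed

lemma resolution_field_lipschitz:
  assumes "\<And>i. i \<le> r \<Longrightarrow> C_k_on (Suc n) UNIV (\<Gamma> i)"
  obtains L where "L \<ge> 0"
    "\<And>h a b. h \<in> {0..1} \<Longrightarrow> a \<in> cball X d \<Longrightarrow> b \<in> cball X d \<Longrightarrow>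
      norm (resolution_field r \<Gamma> h a - resolution_field r \<Gamma> h b) \<le> L * norm (a - b)"
proof -
  have "\<exists>L\<ge>0. \<forall>a\<in>cball X d. \<forall>b\<in>cball X d. norm (\<Gamma> i a - \<Gamma> i b) \<le> L * norm (a - b)" if "i \<le> r" for i
    using C_k_on_imp_local_lipschitz[OF assms[OF that]] by metis
  then obtain L where L: "\<And>i. i \<le> r \<Longrightarrow> L i \<ge> 0"
    "\<And>i a b. i \<le> r \<Longrightarrow> a \<in> cball X d \<Longrightarrow> b \<in> cball X d \<Longrightarrow> norm (\<Gamma> i a - \<Gamma> i b) \<le> L i * norm (a - b)"
    by metis
  show thesis
  proof (rule that[of "\<Sum>i\<le>r. L i"])
    fix h :: real and a b assume h: "h \<in> {0..1}" and ab: "a \<in> cball X d" "b \<in> cball X d"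
    have "norm (resolution_field r \<Gamma> h a - resolution_field r \<Gamma> h b)
        = norm (\<Sum>i\<le>r. h ^ i *\<^sub>R (\<Gamma> i a - \<Gamma> i b))"
      by (simp add: resolution_field_def scaleR_diff_right sum_subtractf)
    also have "\<dots> \<le> (\<Sum>i\<le>r. L i * norm (a - b))"
    proof (rule sum_norm_le)
      fix i assume "i \<in> {..r}"
      then have "norm (\<Gamma> i a - \<Gamma> i b) \<le> L i * norm (a - b)" using L(2) ab by simp
      moreover have "h ^ i \<le> 1" using h by (simp add: power_le_one)
      ultimately show "norm (h ^ i *\<^sub>R (\<Gamma> i a - \<Gamma> i b)) \<le> L i * norm (a - b)"
        using h mult_mono[of "h ^ i" 1 "norm (\<Gamma> i a - \<Gamma> i b)" "L i * norm (a - b)"] by simp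
    qed
    finally show "norm (resolution_field r \<Gamma> h a - resolution_field r \<Gamma> h b) \<le> (\<Sum>i\<le>r. L i) * norm (a - b)"
      by (simp add: sum_distrib_right)
  qed (use L in \<open>auto intro: sum_nonneg\<close>)
qed

text \<open>The claim covers all solutions at once, so it also serves a merely continuous competitor
  \<open>\<Gamma>'\<close>, whose solutions may fail to be unique.\<close>

lemma eventually_solution_in_cball:
  assumes cont: "\<And>i. i \<le> r \<Longrightarrow> continuous_on UNIV (\<Gamma> i)" and "d > 0"
  shows "\<forall>\<^sub>F h in at_right 0. \<forall>x. solves_ivp (resolution_field r \<Gamma> h) h X x \<longrightarrow>
    (\<forall>t\<in>{0..h}. x t \<in> cball X d)"
proof -
  obtain M where M: "\<And>h y. h \<in> {0..1} \<Longrightarrow> y \<in> cball X d \<Longrightarrow> norm (resolution_field r \<Gamma> h y) \<le> M"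
    using resolution_field_bounded[where r = r and \<Gamma> = \<Gamma>, OF cont] by blast
  show ?thesis
    using eventually_at_right_0_small[OF \<open>d > 0\<close>, of M] eventually_at_right_0_unit
  proof eventually_elim
    case (elim h)
    show ?case
    proof (intro allI impI ballI)
      fix x t assume "solves_ivp (resolution_field r \<Gamma> h) h X x" "t \<in> {0..h}"
      then show "x t \<in> cball X d"
        using elim \<open>d > 0\<close> M by (intro solves_ivp_in_cball[of "resolution_field r \<Gamma> h" h X x d M t]) auto
    qed
  qed
qed

lemma eventually_solution_exists:
  assumes smooth: "\<And>i. i \<le> r \<Longrightarrow> C_k_on (Suc n) UNIV (\<Gamma> i)"
  shows "\<forall>\<^sub>F h in at_right 0. \<exists>x. solves_ivp (resolution_field r \<Gamma> h) h X x"
proof -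
  obtain M where M: "\<And>h y. h \<in> {0..1} \<Longrightarrow> y \<in> cball X 1 \<Longrightarrow> norm (resolution_field r \<Gamma> h y) \<le> M"
    using resolution_field_bounded[where r = r and \<Gamma> = \<Gamma>, OF C_k_on_imp_continuous_on[OF smooth]] by blast
  obtain L where L: "L \<ge> 0"
    "\<And>h a b. h \<in> {0..1} \<Longrightarrow> a \<in> cball X 1 \<Longrightarrow> b \<in> cball X 1 \<Longrightarrow>
      norm (resolution_field r \<Gamma> h a - resolution_field r \<Gamma> h b) \<le> L * norm (a - b)"
    using resolution_field_lipschitz[where r = r and \<Gamma> = \<Gamma>, OF smooth] by blast
  show ?thesis
    using eventually_at_right_0_small[OF zero_less_one, of M]
      eventually_at_right_0_small[OF zero_less_one, of L] eventually_at_right_0_unit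
  proof eventually_elim
    case (elim h)
    then show ?case
      using L M by (intro solves_ivp_exists[of 1 h L X "resolution_field r \<Gamma> h" M]) auto
  qed
qed

subsection \<open>Uniqueness of the coefficients\<close>

lemma eventually_at_right_0_sqrt:
  "(\<forall>\<^sub>F s in at_right 0. P (sqrt s)) \<longleftrightarrow> (\<forall>\<^sub>F h in at_right 0. P h)"
proof
  have "filterlim (\<lambda>h::real. h\<^sup>2) (at_right 0) (at_right 0)"
    unfolding filterlim_at
    by (auto intro!: tendsto_eq_intros simp: eventually_at_right_field intro: exI[of _ 1])
  moreover assume "\<forall>\<^sub>F s in at_right 0. P (sqrt s)"
  ultimately have "\<forall>\<^sub>F h in at_right 0. P (sqrt (h\<^sup>2))"
    by (rule eventually_compose_filterlim[rotated])
  with eventually_at_right_0_unit show "\<forall>\<^sub>F h in at_right 0. P h"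
    by eventually_elim simp
next
  have "filterlim sqrt (at_right 0) (at_right 0)"
    unfolding filterlim_at
    by (auto intro!: tendsto_eq_intros simp: eventually_at_right_field intro: exI[of _ 1])
  moreover assume "\<forall>\<^sub>F h in at_right 0. P h"
  ultimately show "\<forall>\<^sub>F s in at_right 0. P (sqrt s)"
    by (rule eventually_compose_filterlim[rotated])
qed

lemma resolution_odeI:
  assumes "\<And>i. i \<le> r \<Longrightarrow> continuous_on UNIV (\<Gamma> i)"
    and ex: "\<And>X. \<forall>\<^sub>F h in at_right 0. \<exists>x. solves_ivp (resolution_field r \<Gamma> h) h X x"
    and close: "\<And>X e. e > 0 \<Longrightarrow> \<forall>\<^sub>F h in at_right 0. \<forall>x. solves_ivp (resolution_field r \<Gamma> h) h X x \<longrightarrow>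
      norm (x h - \<Phi> X h) \<le> e * h ^ (r + 1)"
  shows "resolution_ode r \<Phi> \<Gamma>"
  unfolding resolution_ode_def solves_resolution_ode_iff
proof (intro conjI allI impI)
  fix X
  show "\<forall>\<^sub>F s in at_right 0. \<exists>x. solves_ivp (resolution_field r \<Gamma> (sqrt s)) (sqrt s) X x"
    using ex by (subst eventually_at_right_0_sqrt)
  fix x assume x: "\<forall>\<^sub>F s in at_right 0. solves_ivp (resolution_field r \<Gamma> (sqrt s)) (sqrt s) X (x s)"
  show "(\<lambda>s. norm (x s (sqrt s) - \<Phi> X (sqrt s))) \<in> o[at_right 0](\<lambda>s. sqrt s ^ (r + 1))"
  proof (rule landau_o.smallI)
    fix e :: real assume "e > 0"
    from eventually_at_right_0_sqrt[THEN iffD2, OF close[OF this, of X]] x eventually_at_right_0_unit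
    show "\<forall>\<^sub>F s in at_right 0. norm (norm (x s (sqrt s) - \<Phi> X (sqrt s))) \<le> e * norm (sqrt s ^ (r + 1))"
      by eventually_elim simp
  qed
qed (use assms(1) in blast)

text \<open>The definition speaks of selections of solutions; choosing one solution for each
  \<open>s\<close> turns it into a statement about each single \<open>h\<close>.\<close>

lemma resolution_odeD:
  assumes "resolution_ode r \<Phi> \<Gamma>" and "e > 0"
  shows "\<forall>\<^sub>F h in at_right 0. \<exists>x. solves_ivp (resolution_field r \<Gamma> h) h X x \<and>
    norm (x h - \<Phi> X h) \<le> e * h ^ (r + 1)"
proof -
  let ?sol = "\<lambda>s x. solves_ivp (resolution_field r \<Gamma> (sqrt s)) (sqrt s) X x"
  from assms(1) have ex: "\<forall>\<^sub>F s in at_right 0. \<exists>x. ?sol s x"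
    and close: "\<And>x. \<forall>\<^sub>F s in at_right 0. ?sol s (x s) \<Longrightarrow>
      (\<lambda>s. norm (x s (sqrt s) - \<Phi> X (sqrt s))) \<in> o[at_right 0](\<lambda>s. sqrt s ^ (r + 1))"
    unfolding resolution_ode_def solves_resolution_ode_iff by blast+
  define x where "x s = (SOME x. ?sol s x)" for s
  have sol: "\<forall>\<^sub>F s in at_right 0. ?sol s (x s)"
    using ex
  proof eventually_elim
    case (elim s)
    then show ?case unfolding x_def by (rule someI_ex[of "?sol s"])
  qed
  from sol landau_o.smallD[OF close[OF sol] \<open>e > 0\<close>] eventually_at_right_0_unit
  have "\<forall>\<^sub>F s in at_right 0. \<exists>x. ?sol s x \<and> norm (x (sqrt s) - \<Phi> X (sqrt s)) \<le> e * sqrt s ^ (r + 1)"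
    by eventually_elim (intro exI conjI, assumption, simp)
  then show ?thesis by (subst (asm) eventually_at_right_0_sqrt)
qed

section \<open>Comparison of two resolution fields\<close>

lemma eventually_cball_close:
  fixes f :: "'a::euclidean_space \<Rightarrow> 'b::euclidean_space"
  assumes "continuous_on UNIV f" "e > 0"
  shows "\<forall>\<^sub>F d in at_right 0. \<forall>a\<in>cball X d. norm (f a - f X) \<le> e"
proof -
  from assms obtain d where "d > 0" "\<And>a. dist a X < d \<Longrightarrow> dist (f a) (f X) < e"
    unfolding continuous_on_iff by blast
  then show ?thesis
    unfolding eventually_at_right_field
    by (intro exI[of _ d]) (force simp: dist_norm norm_minus_commute less_imp_le)
qed

text \<open>Terms before \<open>j\<close> agree and are Lipschitz. Term \<open>j\<close> equals its
  value at \<open>X\<close> up to an error that is small by continuity. Later terms carry an extra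
  factor \<open>h\<close>. The radius \<open>d\<close> bounds both the ball and \<open>h\<close>, so
  one smallness condition serves all three cases.\<close>

lemma resolution_term_bound:
  fixes \<Gamma> \<Gamma>' :: "nat \<Rightarrow> 'a \<Rightarrow> 'a::euclidean_space"
  assumes cont: "continuous_on UNIV (\<Gamma>' i)"
    and smooth: "C_k_on (Suc n) UNIV (\<Gamma> i)"
    and eq: "i < j \<Longrightarrow> \<Gamma>' i = \<Gamma> i" and "e > 0"
  shows "\<exists>L\<ge>0. \<forall>\<^sub>F d in at_right 0. \<forall>h\<in>{0<..d}. \<forall>a\<in>cball X d. \<forall>b\<in>cball X d.
    norm (h ^ i *\<^sub>R (\<Gamma>' i a - \<Gamma> i b) - (if i = j then h ^ j *\<^sub>R (\<Gamma>' j X - \<Gamma> j X) else 0))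
      \<le> L * norm (a - b) + e * h ^ j"
proof -
  have cont': "continuous_on UNIV (\<Gamma> i)"
    by (rule C_k_on_imp_continuous_on[OF smooth])
  consider "i < j" | "i = j" | "j < i" by linarith
  then show ?thesis
  proof cases
    case 1
    obtain L where L: "L \<ge> 0"
      "\<And>a b. a \<in> cball X 1 \<Longrightarrow> b \<in> cball X 1 \<Longrightarrow> norm (\<Gamma> i a - \<Gamma> i b) \<le> L * norm (a - b)"
      using C_k_on_imp_local_lipschitz[OF smooth] by blast
    have "\<forall>\<^sub>F d in at_right 0. \<forall>h\<in>{0<..d}. \<forall>a\<in>cball X d. \<forall>b\<in>cball X d.
      norm (h ^ i *\<^sub>R (\<Gamma>' i a - \<Gamma> i b) - (if i = j then h ^ j *\<^sub>R (\<Gamma>' j X - \<Gamma> j X) else 0))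
        \<le> L * norm (a - b) + e * h ^ j"
      using eventually_at_right_0_unit
    proof eventually_elim
      case (elim d)
      show ?case
      proof (intro ballI)
        fix h :: real and a b assume h: "h \<in> {0<..d}" and ab: "a \<in> cball X d" "b \<in> cball X d"
        have "h ^ i * norm (\<Gamma> i a - \<Gamma> i b) \<le> 1 * (L * norm (a - b))"
          using h ab elim by (intro mult_mono L power_le_one) auto
        moreover have "0 \<le> e * h ^ j" using h \<open>e > 0\<close> by simp
        ultimately show "norm (h ^ i *\<^sub>R (\<Gamma>' i a - \<Gamma> i b) -
            (if i = j then h ^ j *\<^sub>R (\<Gamma>' j X - \<Gamma> j X) else 0)) \<le> L * norm (a - b) + e * h ^ j"
          using 1 eq h by simp
      qed
    qed
    with L(1) show ?thesis by blast
  next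
    case 2
    have e2: "e / 2 > 0" using \<open>e > 0\<close> by simp
    from eventually_cball_close[OF cont e2, of X] eventually_cball_close[OF cont' e2, of X]
    have "\<forall>\<^sub>F d in at_right 0. \<forall>h\<in>{0<..d}. \<forall>a\<in>cball X d. \<forall>b\<in>cball X d.
      norm (h ^ i *\<^sub>R (\<Gamma>' i a - \<Gamma> i b) - (if i = j then h ^ j *\<^sub>R (\<Gamma>' j X - \<Gamma> j X) else 0))
        \<le> 0 * norm (a - b) + e * h ^ j"
    proof eventually_elim
      case (elim d)
      show ?case
      proof (intro ballI)
        fix h :: real and a b assume h: "h \<in> {0<..d}" and ab: "a \<in> cball X d" "b \<in> cball X d"
        have "norm (h ^ j *\<^sub>R (\<Gamma>' j a - \<Gamma> j b) - h ^ j *\<^sub>R (\<Gamma>' j X - \<Gamma> j X))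
            = norm (h ^ j *\<^sub>R ((\<Gamma>' j a - \<Gamma>' j X) - (\<Gamma> j b - \<Gamma> j X)))"
          by (simp add: algebra_simps)
        also have "\<dots> = h ^ j * norm ((\<Gamma>' j a - \<Gamma>' j X) - (\<Gamma> j b - \<Gamma> j X))"
          using h by simp
        also have "norm ((\<Gamma>' j a - \<Gamma>' j X) - (\<Gamma> j b - \<Gamma> j X)) \<le> e / 2 + e / 2"
          using elim ab 2 by (intro order_trans[OF norm_triangle_ineq4 add_mono]) auto
        finally show "norm (h ^ i *\<^sub>R (\<Gamma>' i a - \<Gamma> i b) -
            (if i = j then h ^ j *\<^sub>R (\<Gamma>' j X - \<Gamma> j X) else 0)) \<le> 0 * norm (a - b) + e * h ^ j"
          using 2 h by (simp add: mult.commute mult_left_mono)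
      qed
    qed
    then show ?thesis by blast
  next
    case 3
    \<comment> \<open>Bounds the difference on a ball where each of the two coefficients varies by
      at most 1, whence the \<open>+ 2\<close>.\<close>
    define C where "C = norm (\<Gamma>' i X) + norm (\<Gamma> i X) + 2"
    from eventually_cball_close[OF cont zero_less_one, of X]
      eventually_cball_close[OF cont' zero_less_one, of X]
      eventually_at_right_0_unit eventually_at_right_0_small[OF \<open>e > 0\<close>, of C]
    have "\<forall>\<^sub>F d in at_right 0. \<forall>h\<in>{0<..d}. \<forall>a\<in>cball X d. \<forall>b\<in>cball X d.
      norm (h ^ i *\<^sub>R (\<Gamma>' i a - \<Gamma> i b) - (if i = j then h ^ j *\<^sub>R (\<Gamma>' j X - \<Gamma> j X) else 0))
        \<le> 0 * norm (a - b) + e * h ^ j"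
    proof eventually_elim
      case (elim d)
      show ?case
      proof (intro ballI)
        fix h :: real and a b assume h: "h \<in> {0<..d}" and ab: "a \<in> cball X d" "b \<in> cball X d"
        have "norm (\<Gamma>' i a - \<Gamma>' i X) \<le> 1" "norm (\<Gamma> i b - \<Gamma> i X) \<le> 1"
          using elim ab by auto
        then have C: "norm (\<Gamma>' i a - \<Gamma> i b) \<le> C"
          using norm_triangle_ineq4[of "\<Gamma>' i a" "\<Gamma> i b"] norm_triangle_sub[of "\<Gamma>' i a" "\<Gamma>' i X"]
            norm_triangle_sub[of "\<Gamma> i b" "\<Gamma> i X"]
          unfolding C_def by linarith
        have "C \<ge> 0" by (simp add: C_def)
        have "h ^ i * norm (\<Gamma>' i a - \<Gamma> i b) \<le> h ^ (j + 1) * C"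
          using h elim 3 C by (intro mult_mono power_decreasing) auto
        also have "\<dots> = h ^ j * (C * h)" by simp
        also have "C * h \<le> C * d" using h \<open>C \<ge> 0\<close> by (intro mult_left_mono) auto
        also have "C * d \<le> e" using elim by simp
        finally show "norm (h ^ i *\<^sub>R (\<Gamma>' i a - \<Gamma> i b) -
            (if i = j then h ^ j *\<^sub>R (\<Gamma>' j X - \<Gamma> j X) else 0)) \<le> 0 * norm (a - b) + e * h ^ j"
          using 3 h by (simp add: mult.commute mult_left_mono)
      qed
    qed
    then show ?thesis by blast
  qed
qed

lemma resolution_field_diff_bound:
  fixes \<Gamma> \<Gamma>' :: "nat \<Rightarrow> 'a \<Rightarrow> 'a::euclidean_space"
  assumes cont: "\<And>i. i \<le> r \<Longrightarrow> continuous_on UNIV (\<Gamma>' i)"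
    and smooth: "\<And>i. i \<le> r \<Longrightarrow> C_k_on (Suc n) UNIV (\<Gamma> i)"
    and eq: "\<And>i. i < j \<Longrightarrow> \<Gamma>' i = \<Gamma> i" and "j \<le> r" and "e > 0"
  obtains L d where "L \<ge> 0" "d > 0"
    "\<And>h a b. 0 < h \<Longrightarrow> h \<le> d \<Longrightarrow> a \<in> cball X d \<Longrightarrow> b \<in> cball X d \<Longrightarrow>
      norm (resolution_field r \<Gamma>' h a - resolution_field r \<Gamma> h b - h ^ j *\<^sub>R (\<Gamma>' j X - \<Gamma> j X))
        \<le> L * norm (a - b) + e * h ^ j"
proof -
  let ?T = "\<lambda>h a b i. h ^ i *\<^sub>R (\<Gamma>' i a - \<Gamma> i b) - (if i = j then h ^ j *\<^sub>R (\<Gamma>' j X - \<Gamma> j X) else 0)"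
  \<comment> \<open>The error is split evenly over the \<open>r + 1\<close> summands.\<close>
  define e' where "e' = e / real (Suc r)"
  have "e' > 0" using \<open>e > 0\<close> by (simp add: e'_def)
  have "\<forall>i\<in>{..r}. \<exists>L. 0 \<le> L \<and> (\<forall>\<^sub>F d in at_right 0. \<forall>h\<in>{0<..d}. \<forall>a\<in>cball X d. \<forall>b\<in>cball X d.
    norm (?T h a b i) \<le> L * norm (a - b) + e' * h ^ j)"
  proof
    fix i assume "i \<in> {..r}"
    then have "i \<le> r" by simp
    from resolution_term_bound[of \<Gamma>' i n \<Gamma> j e' X, OF cont[OF this] smooth[OF this] eq \<open>e' > 0\<close>]
    show "\<exists>L. 0 \<le> L \<and> (\<forall>\<^sub>F d in at_right 0. \<forall>h\<in>{0<..d}. \<forall>a\<in>cball X d. \<forall>b\<in>cball X d.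
      norm (?T h a b i) \<le> L * norm (a - b) + e' * h ^ j)"
      by blast
  qed
  from bchoice[OF this] obtain L where L: "\<And>i. i \<in> {..r} \<Longrightarrow> 0 \<le> L i"
    "\<And>i. i \<in> {..r} \<Longrightarrow> \<forall>\<^sub>F d in at_right 0. \<forall>h\<in>{0<..d}. \<forall>a\<in>cball X d. \<forall>b\<in>cball X d.
      norm (?T h a b i) \<le> L i * norm (a - b) + e' * h ^ j"
    by blast
  have "\<forall>\<^sub>F d in at_right 0. \<forall>i\<in>{..r}. \<forall>h\<in>{0<..d}. \<forall>a\<in>cball X d. \<forall>b\<in>cball X d.
      norm (?T h a b i) \<le> L i * norm (a - b) + e' * h ^ j"
    using L(2) by (intro eventually_ball_finite) auto
  with eventually_at_right_0_unit have "\<forall>\<^sub>F d in at_right 0. 0 < d \<and>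
     (\<forall>i\<in>{..r}. \<forall>h\<in>{0<..d}. \<forall>a\<in>cball X d. \<forall>b\<in>cball X d.
      norm (?T h a b i) \<le> L i * norm (a - b) + e' * h ^ j)"
    by eventually_elim simp
  from eventually_happens'[OF trivial_limit_at_right_real this]
  obtain d where d: "d > 0" "\<forall>i\<in>{..r}. \<forall>h\<in>{0<..d}. \<forall>a\<in>cball X d. \<forall>b\<in>cball X d.
      norm (?T h a b i) \<le> L i * norm (a - b) + e' * h ^ j"
    by blast
  show thesis
  proof (rule that[of "\<Sum>i\<le>r. L i" d])
    fix h :: real and a b
    assume hab: "0 < h" "h \<le> d" "a \<in> cball X d" "b \<in> cball X d"
    have "resolution_field r \<Gamma>' h a - resolution_field r \<Gamma> h b - h ^ j *\<^sub>R (\<Gamma>' j X - \<Gamma> j X)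
        = (\<Sum>i\<le>r. ?T h a b i)"
      using \<open>j \<le> r\<close> by (simp add: resolution_field_def sum_subtractf scaleR_diff_right)
    also have "norm \<dots> \<le> (\<Sum>i\<le>r. L i * norm (a - b) + e' * h ^ j)"
      by (rule sum_norm_le) (use d(2) hab in auto)
    also have "\<dots> = (\<Sum>i\<le>r. L i) * norm (a - b) + e * h ^ j"
      by (simp add: sum.distrib sum_distrib_right e'_def del: of_nat_Suc)
    finally show "norm (resolution_field r \<Gamma>' h a - resolution_field r \<Gamma> h b - h ^ j *\<^sub>R (\<Gamma>' j X - \<Gamma> j X))
        \<le> (\<Sum>i\<le>r. L i) * norm (a - b) + e * h ^ j" .
  qed (use L d in \<open>auto intro: sum_nonneg\<close>)
qed

text \<open>The supremum of the distance of the two solutions bounds its own derivative, which replaces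
  Gronwall's inequality on intervals that shrink to zero.\<close>

lemma resolution_coeff_unique:
  fixes \<Gamma> \<Gamma>' :: "nat \<Rightarrow> 'a \<Rightarrow> 'a::euclidean_space"
  assumes cont: "\<And>i. i \<le> r \<Longrightarrow> continuous_on UNIV (\<Gamma>' i)"
    and smooth: "\<And>i. i \<le> r \<Longrightarrow> C_k_on (Suc n) UNIV (\<Gamma> i)"
    and eq: "\<And>i. i < j \<Longrightarrow> \<Gamma>' i = \<Gamma> i" and "j \<le> r"
    and close: "\<And>e. e > 0 \<Longrightarrow> \<forall>\<^sub>F h in at_right 0. \<exists>x y.
      solves_ivp (resolution_field r \<Gamma>' h) h X x \<and> solves_ivp (resolution_field r \<Gamma> h) h X y \<and>
      norm (x h - y h) \<le> e * h ^ (r + 1)"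
  shows "\<Gamma>' j X = \<Gamma> j X"
proof -
  define v where "v = \<Gamma>' j X - \<Gamma> j X"
  \<comment> \<open>One \<open>e\<close> comes from the assumed closeness at time \<open>h\<close>,
    one from the error in comparing the fields, and one from the Lipschitz term for small
    \<open>h\<close>.\<close>
  have v: "norm v \<le> 3 * e" if e: "e > 0" for e
  proof -
    obtain L d where L: "L \<ge> 0" and d: "d > 0"
      "\<And>h a b. 0 < h \<Longrightarrow> h \<le> d \<Longrightarrow> a \<in> cball X d \<Longrightarrow> b \<in> cball X d \<Longrightarrow>
        norm (resolution_field r \<Gamma>' h a - resolution_field r \<Gamma> h b - h ^ j *\<^sub>R v)
          \<le> L * norm (a - b) + e * h ^ j"
      unfolding v_def
      using resolution_field_diff_bound[where r = r and \<Gamma> = \<Gamma> and \<Gamma>' = \<Gamma>' and j = j, OF cont smooth eq \<open>j \<le> r\<close> e]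
      by blast
    have near: "\<forall>\<^sub>F h in at_right 0. \<forall>x. solves_ivp (resolution_field r \<Gamma> h) h X x \<longrightarrow>
        (\<forall>t\<in>{0..h}. x t \<in> cball X d)"
      by (rule eventually_solution_in_cball[OF C_k_on_imp_continuous_on[OF smooth] d(1)])
    have near': "\<forall>\<^sub>F h in at_right 0. \<forall>x. solves_ivp (resolution_field r \<Gamma>' h) h X x \<longrightarrow>
        (\<forall>t\<in>{0..h}. x t \<in> cball X d)"
      by (rule eventually_solution_in_cball[OF cont d(1)])
    \<comment> \<open>The inequality does not mention \<open>h\<close>, so it follows as soon as it
      holds for small \<open>h\<close>. Below, \<open>L * h < 1 / 2\<close> serves to absorb the
      supremum of \<open>w\<close>, and \<open>2 * L * (norm v + e) * h < e\<close> to turn the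
      Lipschitz term into one \<open>e\<close>.\<close>
    have "\<forall>\<^sub>F h::real in at_right 0. norm v \<le> 3 * e"
      using eventually_at_right_0_unit
        eventually_at_right_0_small[OF d(1), of 1]
        eventually_at_right_0_small[OF half_gt_zero[OF zero_less_one], of L]
        eventually_at_right_0_small[OF e, of "2 * L * (norm v + e)"]
        near near'
        close[OF e]
    proof eventually_elim
      case (elim h)
      then have h: "0 < h" "h \<le> 1" "h < d" "L * h < 1 / 2" "2 * L * (norm v + e) * h < e"
        by simp_all
      from elim obtain x y where x: "solves_ivp (resolution_field r \<Gamma>' h) h X x"
        and y: "solves_ivp (resolution_field r \<Gamma> h) h X y"
        and xy: "norm (x h - y h) \<le> e * h ^ (r + 1)"
        by blast
      define w where "w t = x t - y t" for t
      define w' where "w' t = resolution_field r \<Gamma>' h (x t) - resolution_field r \<Gamma> h (y t)" for t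
      have w: "(w has_vector_derivative w' t) (at t within {0..h})" if "t \<in> {0..h}" for t
        using x y that unfolding w_def w'_def solves_ivp_def
        by (intro has_vector_derivative_diff) auto
      have w0: "w 0 = 0"
        using x y by (simp add: w_def solves_ivp_def)
      have "continuous_on {0..h} w"
        using w by (rule continuous_on_vector_derivative)
      then have "continuous_on {0..h} (\<lambda>t. norm (w t))"
        by (rule continuous_on_norm)
      then obtain s where s: "s \<in> {0..h}" "\<And>t. t \<in> {0..h} \<Longrightarrow> norm (w t) \<le> norm (w s)"
        using continuous_attains_sup[of "{0..h}" "\<lambda>t. norm (w t)"] h(1) by auto
      define B where "B = L * norm (w s) + e * h ^ j"
      have w'_bound: "norm (w' t - h ^ j *\<^sub>R v) \<le> B" if t: "t \<in> {0..h}" for t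
      proof -
        have "norm (w' t - h ^ j *\<^sub>R v) \<le> L * norm (w t) + e * h ^ j"
          unfolding w'_def w_def using h t elim x y by (intro d(2)) auto
        also have "\<dots> \<le> B"
          unfolding B_def using s(2)[OF t] L by (intro add_right_mono mult_left_mono)
        finally show ?thesis .
      qed
      \<comment> \<open>Removing the expected drift \<open>t h^j v\<close> leaves a function whose
        derivative is bounded by \<open>B\<close>.\<close>
      have "((\<lambda>t. w t - t *\<^sub>R (h ^ j *\<^sub>R v)) has_vector_derivative w' t - h ^ j *\<^sub>R v) (at t within {0..h})"
        if "t \<in> {0..h}" for t
        by (intro has_vector_derivative_diff w that) (auto intro!: derivative_eq_intros simp: has_vector_derivative_def)
      from mean_value_bound[OF this _ w'_bound]
      have lin: "norm (w t - t *\<^sub>R (h ^ j *\<^sub>R v)) \<le> B * t" if "t \<in> {0..h}" for t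
        using that w0 by force
      have "norm (w s) \<le> norm (s *\<^sub>R (h ^ j *\<^sub>R v)) + B * s"
        using lin[OF s(1)] norm_triangle_sub[of "w s" "s *\<^sub>R (h ^ j *\<^sub>R v)"] by linarith
      also have "\<dots> = s * (h ^ j * norm v + B)"
        using s(1) h by (simp add: algebra_simps)
      also have "\<dots> \<le> h * (h ^ j * norm v + B)"
        using s(1) h L \<open>e > 0\<close> by (intro mult_right_mono) (auto simp: B_def intro!: add_nonneg_nonneg)
      also have "\<dots> = h ^ (j + 1) * (norm v + e) + (L * h) * norm (w s)"
        by (simp add: B_def algebra_simps)
      \<comment> \<open>Half of \<open>norm (w s)\<close> can now be moved to the left-hand side,
        which bounds the supremum by a multiple of \<open>h^(j+1)\<close>.\<close>
      also have "\<dots> \<le> h ^ (j + 1) * (norm v + e) + (1 / 2) * norm (w s)"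
        using h by (intro add_left_mono mult_right_mono) auto
      finally have ws: "norm (w s) \<le> 2 * (h ^ (j + 1) * (norm v + e))"
        by simp
      have "h ^ (j + 1) * norm v = norm (h *\<^sub>R (h ^ j *\<^sub>R v))"
        using h by simp
      also have "\<dots> \<le> norm (w h) + norm (w h - h *\<^sub>R (h ^ j *\<^sub>R v))"
        using norm_triangle_sub[of "h *\<^sub>R (h ^ j *\<^sub>R v)" "w h"] by (simp add: norm_minus_commute)
      also have "norm (w h) \<le> e * h ^ (j + 1)"
      proof -
        have "norm (w h) \<le> e * h ^ (r + 1)" using xy by (simp add: w_def)
        also have "\<dots> \<le> e * h ^ (j + 1)"
          using h \<open>e > 0\<close> \<open>j \<le> r\<close> by (intro mult_left_mono power_decreasing) auto
        finally show ?thesis .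
      qed
      also have "norm (w h - h *\<^sub>R (h ^ j *\<^sub>R v)) \<le> B * h"
        using h by (intro lin) auto
      also have "B * h \<le> (L * (2 * (h ^ (j + 1) * (norm v + e))) + e * h ^ j) * h"
        unfolding B_def using h L ws by (intro mult_right_mono add_right_mono mult_left_mono) auto
      also have "\<dots> = h ^ (j + 1) * (2 * L * (norm v + e) * h + e)"
        by (simp add: algebra_simps)
      also have "\<dots> \<le> h ^ (j + 1) * (e + e)"
        using h by (intro mult_left_mono) auto
      finally have "h ^ (j + 1) * norm v \<le> h ^ (j + 1) * (3 * e)"
        by (simp add: algebra_simps)
      then show ?case
        using h(1) by simp
    qed
    then show ?thesis by simp
  qed
  have "norm v \<le> 0 + e" if "e > 0" for e
    using v[of "e / 3"] that by simp
  then have "norm v \<le> 0"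
    by (rule field_le_epsilon)
  then show ?thesis by (simp add: v_def)
qed

subsection \<open>Expansion of the solutions\<close>

text \<open>The \<open>k\<close>-th time derivative of a solution, as a function of the state.  With \<open>\<Gamma> i = 0\<close> for
  \<open>i > r\<close>, the sum is exact as soon as \<open>B \<ge> k * r\<close>.\<close>

definition flow_derivative :: "(nat \<Rightarrow> 'a \<Rightarrow> 'a) \<Rightarrow> nat \<Rightarrow> nat \<Rightarrow> real \<Rightarrow> 'a \<Rightarrow> 'a::euclidean_space" where
  "flow_derivative \<Gamma> B k h y = (if k = 0 then y else \<Sum>i\<le>B. h ^ i *\<^sub>R H_map \<Gamma> k i y)"

lemma resolution_field_extend:
  assumes "\<And>i. r < i \<Longrightarrow> \<Gamma> i = (\<lambda>X. 0)" "r \<le> B"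
  shows "resolution_field r \<Gamma> h y = (\<Sum>i\<le>B. h ^ i *\<^sub>R \<Gamma> i y)"
  unfolding resolution_field_def using assms by (intro sum.mono_neutral_left) auto

text \<open>Both factors are polynomials in \<open>h\<close>; sorting their product by the total
  power \<open>i = l + p\<close> reproduces the recursion of \<open>H_map\<close>. Truncation at
  \<open>B\<close> loses nothing: a term with \<open>l + p > B\<close> has \<open>l > k * r\<close>
  or \<open>p > r\<close> and vanishes.\<close>

lemma flow_derivative_step:
  assumes zero: "\<And>i. r < i \<Longrightarrow> \<Gamma> i = (\<lambda>X. 0)"
    and diff: "\<And>j l X. 0 < j \<Longrightarrow> j \<le> k \<Longrightarrow> H_map \<Gamma> j l differentiable (at X)"
    and "0 < k" "k * r + r \<le> B"
  shows "(\<Sum>l\<le>B. h ^ l *\<^sub>R frechet_derivative (H_map \<Gamma> k l) (at y) (resolution_field r \<Gamma> h y))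
    = flow_derivative \<Gamma> B (Suc k) h y"
proof -
  define A where "A l p = h ^ (l + p) *\<^sub>R frechet_derivative (H_map \<Gamma> k l) (at y) (\<Gamma> p y)" for l p
  have lin: "linear (frechet_derivative (H_map \<Gamma> k l) (at y))" for l
    using diff \<open>0 < k\<close> by (intro linear_frechet_derivative) simp
  have A0: "A l p = 0" if "B < l + p" for l p
  proof (cases "k * r < l")
    case True
    then have "H_map \<Gamma> k l = (\<lambda>X. 0)"
      using zero diff by (intro H_map_eq_0[of r]) auto
    then show ?thesis by (simp add: A_def)
  next
    case False
    then have "\<Gamma> p = (\<lambda>X. 0)" using that assms(4) by (intro zero) simp
    then show ?thesis by (simp add: A_def linear_0[OF lin])
  qed
  have "h ^ l *\<^sub>R frechet_derivative (H_map \<Gamma> k l) (at y) (resolution_field r \<Gamma> h y) = (\<Sum>p\<le>B. A l p)" for l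
  proof -
    have "resolution_field r \<Gamma> h y = (\<Sum>p\<le>B. h ^ p *\<^sub>R \<Gamma> p y)"
      using zero assms(4) by (intro resolution_field_extend) auto
    then show ?thesis
      by (simp add: A_def linear_sum[OF lin] linear_cmul[OF lin] scaleR_sum_right power_add)
  qed
  then have "(\<Sum>l\<le>B. h ^ l *\<^sub>R frechet_derivative (H_map \<Gamma> k l) (at y) (resolution_field r \<Gamma> h y))
      = (\<Sum>(l, p)\<in>{..B} \<times> {..B}. A l p)"
    by (simp add: sum.cartesian_product)
  also have "\<dots> = (\<Sum>(l, p)\<in>{(l, p). l + p \<le> B}. A l p)"
    by (rule sum.mono_neutral_right) (auto intro!: A0)
  also have "\<dots> = (\<Sum>i\<le>B. \<Sum>l\<le>i. A l (i - l))"
    by (rule sum.triangle_reindex_eq)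
  also have "\<dots> = flow_derivative \<Gamma> B (Suc k) h y"
    using \<open>0 < k\<close> by (cases k) (simp_all add: flow_derivative_def A_def scaleR_sum_right)
  finally show ?thesis .
qed

text \<open>The chain rule along a solution. The case \<open>k = 0\<close> is separate: there the
  state itself is differentiated, while \<open>H_map \<Gamma> 0\<close> is only a dummy
  value.\<close>

lemma flow_derivative_has_vector_derivative:
  assumes zero: "\<And>i. r < i \<Longrightarrow> \<Gamma> i = (\<lambda>X. 0)"
    and diff: "\<And>j l X. 0 < j \<Longrightarrow> j \<le> k \<Longrightarrow> H_map \<Gamma> j l differentiable (at X)"
    and B: "k * r + r \<le> B"
    and x: "solves_ivp (resolution_field r \<Gamma> h) h X x" and t: "t \<in> {0..h}"
  shows "((\<lambda>t. flow_derivative \<Gamma> B k h (x t)) has_vector_derivative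
    flow_derivative \<Gamma> B (Suc k) h (x t)) (at t within {0..h})"
proof -
  have der: "(x has_vector_derivative resolution_field r \<Gamma> h (x t)) (at t within {0..h})"
    using x t by (simp add: solves_ivp_def)
  show ?thesis
  proof (cases "k = 0")
    case True
    have "resolution_field r \<Gamma> h (x t) = flow_derivative \<Gamma> B (Suc 0) h (x t)"
      using resolution_field_extend[where r = r and B = B, OF zero] B by (simp add: flow_derivative_def)
    with der True show ?thesis by (simp add: flow_derivative_def)
  next
    case False
    have "(H_map \<Gamma> k l has_derivative frechet_derivative (H_map \<Gamma> k l) (at y)) (at y)" for l y
      using diff False by (simp flip: frechet_derivative_works)
    then have "((\<lambda>y. flow_derivative \<Gamma> B k h y) has_derivative
        (\<lambda>v. \<Sum>l\<le>B. h ^ l *\<^sub>R frechet_derivative (H_map \<Gamma> k l) (at (x t)) v)) (at (x t) within x ` {0..h})"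
      using False unfolding flow_derivative_def
      by (auto intro!: has_derivative_sum has_derivative_scaleR_right intro: has_derivative_at_withinI)
    from vector_derivative_diff_chain_within[OF der this]
    show ?thesis
      using flow_derivative_step[OF zero diff _ B, of h "x t"] False by (simp add: o_def)
  qed
qed

text \<open>Taylor's formula in time along the solution, for fixed \<open>h\<close>. Its polynomial
  still depends on \<open>h\<close> through the field and may contain powers beyond
  \<open>h^(r+1)\<close>; these are discarded in \<open>flow_coefficients_match\<close>.\<close>

lemma solution_expansion:
  assumes zero: "\<And>i. r < i \<Longrightarrow> \<Gamma> i = (\<lambda>X. 0)"
    and smooth: "\<And>k i. 0 < k \<Longrightarrow> k \<le> Suc r \<Longrightarrow> C_k_on (Suc r - k) UNIV (H_map \<Gamma> k i)"
    and diff: "\<And>j l X. 0 < j \<Longrightarrow> j \<le> r \<Longrightarrow> H_map \<Gamma> j l differentiable (at X)"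
    and B: "r * r + r \<le> B" and "e > 0"
  shows "\<forall>\<^sub>F h in at_right 0. \<forall>x. solves_ivp (resolution_field r \<Gamma> h) h X x \<longrightarrow>
    norm (x h - (\<Sum>k\<le>r + 1. (h ^ k / fact k) *\<^sub>R flow_derivative \<Gamma> B k h X)) \<le> e * h ^ (r + 1)"
proof -
  have cont: "continuous_on UNIV (H_map \<Gamma> k i)" if "0 < k" "k \<le> Suc r" for k i
    using smooth[OF that] by (rule C_k_on_imp_continuous_on)
  have cont_Gamma: "continuous_on UNIV (\<Gamma> i)" for i
    using cont[of 1 i] by simp
  \<comment> \<open>For \<open>h \<le> 1\<close> this majorizes the oscillation of the top
    derivative independently of \<open>h\<close>. It vanishes at \<open>X\<close>, and solutions
    stay near \<open>X\<close> for small \<open>h\<close>.\<close>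
  define S where "S y = (\<Sum>i\<le>B. norm (H_map \<Gamma> (r + 1) i y - H_map \<Gamma> (r + 1) i X))" for y
  have "continuous_on UNIV S"
    unfolding S_def by (intro continuous_intros cont) auto
  from eventually_cball_close[OF this \<open>e > 0\<close>, of X] eventually_at_right_0_unit
  have "\<forall>\<^sub>F d in at_right 0. 0 < d \<and> (\<forall>y\<in>cball X d. norm (S y - S X) \<le> e)"
    by eventually_elim simp
  from eventually_happens'[OF trivial_limit_at_right_real this]
  obtain d where d: "d > 0" "\<And>y. y \<in> cball X d \<Longrightarrow> norm (S y - S X) \<le> e"
    by blast
  have "S X = 0" by (simp add: S_def)
  have near: "\<forall>\<^sub>F h in at_right 0. \<forall>x. solves_ivp (resolution_field r \<Gamma> h) h X x \<longrightarrow>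
      (\<forall>t\<in>{0..h}. x t \<in> cball X d)"
    by (rule eventually_solution_in_cball[OF cont_Gamma d(1)])
  from near eventually_at_right_0_unit show ?thesis
  proof eventually_elim
    case (elim h)
    show ?case
    proof (intro allI impI)
      fix x assume x: "solves_ivp (resolution_field r \<Gamma> h) h X x"
      then have x0: "x 0 = X" by (simp add: solves_ivp_def)
      have "norm (flow_derivative \<Gamma> B 0 h (x h)
          - (\<Sum>k\<le>r + 1. (h ^ k / fact k) *\<^sub>R flow_derivative \<Gamma> B k h (x 0))) \<le> e * h ^ (r + 1)"
      proof (rule taylor_remainder_bound)
        show "((\<lambda>t. flow_derivative \<Gamma> B k h (x t)) has_vector_derivative
            flow_derivative \<Gamma> B (Suc k) h (x t)) (at t within {0..h})"
          if "k < r + 1" "t \<in> {0..h}" for k t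
        proof (rule flow_derivative_has_vector_derivative[OF zero _ _ x that(2)])
          have "k * r \<le> r * r" using that by (intro mult_le_mono1) simp
          then show "k * r + r \<le> B" using B by linarith
        qed (use diff that in auto)
        show "norm (flow_derivative \<Gamma> B (r + 1) h (x t) - flow_derivative \<Gamma> B (r + 1) h (x 0)) \<le> e"
          if t: "t \<in> {0..h}" for t
        proof -
          have "flow_derivative \<Gamma> B (r + 1) h (x t) - flow_derivative \<Gamma> B (r + 1) h (x 0)
              = (\<Sum>i\<le>B. h ^ i *\<^sub>R (H_map \<Gamma> (r + 1) i (x t) - H_map \<Gamma> (r + 1) i X))"
            by (simp add: flow_derivative_def x0 scaleR_diff_right sum_subtractf)
          also have "norm \<dots> \<le> S (x t)"
            unfolding S_def
          proof (rule sum_norm_le)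
            fix i
            have "h ^ i \<le> 1" using elim by (intro power_le_one) auto
            then show "norm (h ^ i *\<^sub>R (H_map \<Gamma> (r + 1) i (x t) - H_map \<Gamma> (r + 1) i X))
                \<le> norm (H_map \<Gamma> (r + 1) i (x t) - H_map \<Gamma> (r + 1) i X)"
              using elim by (simp add: mult_left_le_one_le)
          qed
          also have "\<dots> \<le> e"
            using d(2)[of "x t"] elim x t \<open>S X = 0\<close> by auto
          finally show ?thesis .
        qed
      qed (use elim in auto)
      then show "norm (x h - (\<Sum>k\<le>r + 1. (h ^ k / fact k) *\<^sub>R flow_derivative \<Gamma> B k h X)) \<le> e * h ^ (r + 1)"
        by (simp add: flow_derivative_def[of _ _ 0] x0)
    qed
  qed
qed

section \<open>Expansion of the template and matching of powers of \<open>h\<close>\<close>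

lemma C_k_on_Phi_coeff:
  assumes "C_k_on N (UNIV \<times> {0..}) (\<lambda>(X, t). \<Phi> X t)" and "j \<le> N"
  shows "C_k_on (N - j) UNIV (Phi_coeff \<Phi> j)"
proof -
  obtain D where D: "D 0 = (\<lambda>(X, t). \<Phi> X t)"
    "\<And>j. j \<le> N \<Longrightarrow> C_k_on (N - j) (UNIV \<times> {0..}) (D j)"
    "\<And>j X t. j < N \<Longrightarrow> 0 \<le> t \<Longrightarrow>
      ((\<lambda>t. D j (X, t)) has_vector_derivative D (Suc j) (X, t)) (at t within {0..})"
    using C_k_on_partial_snd[OF assms(1)] by blast
  have "Phi_coeff \<Phi> j = (\<lambda>X. D j (X, 0))"
    using \<open>j \<le> N\<close> by (intro ext Phi_coeff_eq[OF D(1) D(3)])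
  then show ?thesis
    using C_k_on_slice[OF D(2)[OF \<open>j \<le> N\<close>]] by simp
qed

lemma template_expansion:
  fixes \<Phi> :: "'a::euclidean_space \<Rightarrow> real \<Rightarrow> 'a"
  assumes "C_k_on N (UNIV \<times> {0..}) (\<lambda>(X, t). \<Phi> X t)" and "n \<le> N" and "e > 0"
  shows "\<forall>\<^sub>F h in at_right 0.
    norm (\<Phi> X h - (\<Sum>m\<le>n. (h ^ m / fact m) *\<^sub>R Phi_coeff \<Phi> m X)) \<le> e * h ^ n"
proof -
  obtain D where D: "D 0 = (\<lambda>(X, t). \<Phi> X t)"
    "\<And>j. j \<le> N \<Longrightarrow> C_k_on (N - j) (UNIV \<times> {0..}) (D j)"
    "\<And>j X t. j < N \<Longrightarrow> 0 \<le> t \<Longrightarrow>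
      ((\<lambda>t. D j (X, t)) has_vector_derivative D (Suc j) (X, t)) (at t within {0..})"
    using C_k_on_partial_snd[OF assms(1)] by blast
  have "continuous_on {0..} (\<lambda>t. D n (X, t))"
    using C_k_on_imp_continuous_on[OF D(2)[OF \<open>n \<le> N\<close>]]
    by (rule continuous_on_compose2) (auto intro!: continuous_intros)
  then obtain d where d: "d > 0" "\<And>t. 0 \<le> t \<Longrightarrow> t < d \<Longrightarrow> dist (D n (X, t)) (D n (X, 0)) < e"
    using \<open>e > 0\<close> unfolding continuous_on_iff by (force simp: dist_real_def)
  show ?thesis
    using eventually_at_right_0_unit eventually_at_right_0_small[OF d(1), of 1]
  proof eventually_elim
    case (elim h)
    have "norm (D 0 (X, h) - (\<Sum>m\<le>n. (h ^ m / fact m) *\<^sub>R D m (X, 0))) \<le> e * h ^ n"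
    proof (rule taylor_remainder_bound)
      show "((\<lambda>t. D k (X, t)) has_vector_derivative D (Suc k) (X, t)) (at t within {0..h})"
        if "k < n" "t \<in> {0..h}" for k t
        by (rule has_vector_derivative_within_subset[OF D(3)]) (use that \<open>n \<le> N\<close> in auto)
      show "norm (D n (X, t) - D n (X, 0)) \<le> e" if "t \<in> {0..h}" for t
        using d(2)[of t] that elim by (simp add: dist_norm)
    qed (use elim in auto)
    moreover have "Phi_coeff \<Phi> m X = D m (X, 0)" if "m \<le> n" for m
      using that \<open>n \<le> N\<close> by (intro Phi_coeff_eq[OF D(1) D(3)]) auto
    ultimately show ?case by (simp add: D(1))
  qed
qed

text \<open>The power \<open>h^m\<close> collects the pairs with \<open>k + i = m\<close>, which is
  the sum in the hypothesis on \<open>c\<close>. The finitely many pairs with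
  \<open>k + i > n\<close> contribute O(h^(n+1)); \<open>n \<le> B\<close> makes the rectangle of
  pairs contain the whole triangle \<open>k + i \<le> n\<close>.\<close>

lemma flow_coefficients_match:
  assumes c: "\<And>m. 1 \<le> m \<Longrightarrow> m \<le> n \<Longrightarrow>
      (1 / fact m) *\<^sub>R c m = (\<Sum>k=1..m. (1 / fact k) *\<^sub>R H_map \<Gamma> k (m - k) X)"
    and "c 0 = X" and "n \<le> B" and "e > 0"
  shows "\<forall>\<^sub>F h in at_right 0. norm ((\<Sum>k\<le>n. (h ^ k / fact k) *\<^sub>R flow_derivative \<Gamma> B k h X)
    - (\<Sum>m\<le>n. (h ^ m / fact m) *\<^sub>R c m)) \<le> e * h ^ n"
proof -
  define A where "A h k i = (h ^ (k + i) / fact k) *\<^sub>R H_map \<Gamma> k i X" for h :: real and k i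
  let ?P = "{1..n} \<times> {..B}"
  define C where "C = (\<Sum>(k, i)\<in>?P. norm (H_map \<Gamma> k i X))"
  have "C \<ge> 0" unfolding C_def by (intro sum_nonneg) auto
  have split0: "(\<Sum>k\<le>n. f k) = f 0 + (\<Sum>k=1..n. f k)" for f :: "nat \<Rightarrow> 'a"
    by (simp add: sum.atMost_shift atLeast0AtMost[symmetric] sum.atLeast_Suc_atMost)
  have flow: "(\<Sum>k\<le>n. (h ^ k / fact k) *\<^sub>R flow_derivative \<Gamma> B k h X) = X + (\<Sum>(k, i)\<in>?P. A h k i)" for h
  proof -
    have "(h ^ k / fact k) *\<^sub>R flow_derivative \<Gamma> B k h X = (\<Sum>i\<le>B. A h k i)" if "k \<in> {1..n}" for k
      using that by (simp add: flow_derivative_def A_def scaleR_sum_right power_add)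
    then have "(\<Sum>k=1..n. (h ^ k / fact k) *\<^sub>R flow_derivative \<Gamma> B k h X) = (\<Sum>(k, i)\<in>?P. A h k i)"
      by (simp add: sum.cartesian_product)
    then show ?thesis
      by (simp only: split0) (simp add: flow_derivative_def)
  qed
  have template: "(\<Sum>m\<le>n. (h ^ m / fact m) *\<^sub>R c m) = X + (\<Sum>(k, i)\<in>{(k, i)\<in>?P. k + i \<le> n}. A h k i)" for h
  proof -
    have "(h ^ m / fact m) *\<^sub>R c m = (\<Sum>k=1..m. A h k (m - k))" if m: "m \<in> {1..n}" for m
    proof -
      have "(h ^ m / fact m) *\<^sub>R c m = h ^ m *\<^sub>R ((1 / fact m) *\<^sub>R c m)" by simp
      also have "\<dots> = (\<Sum>k=1..m. A h k (m - k))"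
        using m by (subst c) (auto simp: A_def scaleR_sum_right)
      finally show ?thesis .
    qed
    then have "(\<Sum>m=1..n. (h ^ m / fact m) *\<^sub>R c m) = (\<Sum>(m, k)\<in>Sigma {1..n} (\<lambda>m. {1..m}). A h k (m - k))"
      by (simp add: sum.Sigma)
    also have "\<dots> = (\<Sum>(k, i)\<in>{(k, i)\<in>?P. k + i \<le> n}. A h k i)"
      by (rule sum.reindex_bij_witness[where i = "\<lambda>(k, i). (k + i, k)" and j = "\<lambda>(m, k). (k, m - k)"])
        (use \<open>n \<le> B\<close> in auto)
    finally show ?thesis
      by (simp only: split0) (simp add: \<open>c 0 = X\<close>)
  qed
  show ?thesis
    using eventually_at_right_0_unit eventually_at_right_0_small[OF \<open>e > 0\<close>, of C]
  proof eventually_elim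
    case (elim h)
    let ?Q = "{(k, i)\<in>?P. k + i \<le> n}"
    have diff: "(\<Sum>k\<le>n. (h ^ k / fact k) *\<^sub>R flow_derivative \<Gamma> B k h X) - (\<Sum>m\<le>n. (h ^ m / fact m) *\<^sub>R c m)
        = (\<Sum>(k, i)\<in>?P - ?Q. A h k i)"
      unfolding flow template by (subst sum_diff) auto
    have "norm (\<Sum>(k, i)\<in>?P - ?Q. A h k i) \<le> (\<Sum>z\<in>?P - ?Q. h ^ (n + 1) * (case z of (k, i) \<Rightarrow> norm (H_map \<Gamma> k i X)))"
    proof (rule sum_norm_le)
      fix z assume "z \<in> ?P - ?Q"
      then obtain k i where z: "z = (k, i)" "n + 1 \<le> k + i" by (cases z) auto
      have "h ^ (k + i) / fact k \<le> h ^ (k + i)"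
        using elim mult_left_mono[OF fact_ge_1, of "h ^ (k + i)" k] by (simp add: divide_le_eq)
      also have "\<dots> \<le> h ^ (n + 1)"
        using elim z by (intro power_decreasing) auto
      finally have "(h ^ (k + i) / fact k) * norm (H_map \<Gamma> k i X) \<le> h ^ (n + 1) * norm (H_map \<Gamma> k i X)"
        by (rule mult_right_mono) simp
      moreover have "norm (A h k i) = (h ^ (k + i) / fact k) * norm (H_map \<Gamma> k i X)"
        using elim by (simp add: A_def)
      ultimately show "norm (case z of (k, i) \<Rightarrow> A h k i)
          \<le> h ^ (n + 1) * (case z of (k, i) \<Rightarrow> norm (H_map \<Gamma> k i X))"
        by (simp only: z prod.case)
    qed
    also have "\<dots> \<le> h ^ (n + 1) * C"
      unfolding C_def sum_distrib_left[symmetric]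
      using elim by (intro mult_left_mono sum_mono2) auto
    also have "\<dots> = (C * h) * h ^ n" by simp
    also have "\<dots> \<le> e * h ^ n"
      using elim by (intro mult_right_mono) auto
    finally show ?case unfolding diff .
  qed
qed

section \<open>Existence, formula and uniqueness\<close>

theorem theorem3p1:
  fixes g :: "'z \<Rightarrow> real \<Rightarrow> 'z"
    and \<Phi> :: "'a::euclidean_space \<Rightarrow> real \<Rightarrow> 'a"
    and r :: nat
  assumes template: "equivalent_template g \<Phi>"
    and smooth: "C_k_on (2 * r + 2) (UNIV \<times> {0..}) (\<lambda>(X, \<tau>). \<Phi> X \<tau>)"
    and id0: "\<And>X. \<Phi> X 0 = X"
  shows "\<exists>\<Gamma>. resolution_ode r \<Phi> \<Gamma>
      \<and> (\<forall>\<Gamma>'. resolution_ode r \<Phi> \<Gamma>' \<longrightarrow> (\<forall>j\<le>r. \<Gamma>' j = \<Gamma> j))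
      \<and> (\<forall>k\<in>{1..r}. \<forall>i\<le>r. \<forall>X. H_map \<Gamma> k i differentiable (at X))
      \<and> (\<forall>X. \<Gamma> 0 X = Phi_coeff \<Phi> 1 X)
      \<and> (\<forall>j\<in>{1..r}. \<forall>X. \<Gamma> j X =
            (1 / fact (j + 1)) *\<^sub>R Phi_coeff \<Phi> (j + 1) X
            - (\<Sum>k=2..j+1. (1 / fact k) *\<^sub>R H_map \<Gamma> k (j + 1 - k) X))"
proof -
  define \<Gamma> where "\<Gamma> = gamma_upto \<Phi> (Suc r)"
  \<comment> \<open>\<open>r * r + r\<close> keeps the sums exact while differentiating up to order
    \<open>r + 1\<close>; the \<open>+ 1\<close> secures \<open>r + 1 \<le> B\<close> also when
    \<open>r = 0\<close>.\<close>
  define B where "B = r * r + r + 1"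
  have zero: "\<Gamma> i = (\<lambda>X. 0)" if "r < i" for i
    using that unfolding \<Gamma>_def by (intro gamma_upto_eq_0) simp
  have formula: "\<Gamma> j = gamma_formula \<Phi> \<Gamma> j" if "j \<le> r" for j
    using that unfolding \<Gamma>_def by (intro gamma_upto_eq) simp
  have smooth_Gamma: "C_k_on m UNIV (\<Gamma> i)" if "m + min i r < 2 * r + 2" for m i
    using C_k_on_Phi_coeff[OF smooth] that unfolding \<Gamma>_def by (intro C_k_on_gamma_upto) auto
  \<comment> \<open>Of the \<open>2 * r + 2\<close> derivatives at most \<open>r\<close> are charged
    to the index \<open>i\<close>, which leaves \<open>r + 2\<close> for
    \<open>m + k\<close>.\<close>
  have smooth_H: "C_k_on m UNIV (H_map \<Gamma> k i)" if "0 < k" "m + k \<le> r + 2" for m k i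
    by (rule C_k_on_H_map[where w = "\<lambda>i. min i r" and N = "2 * r + 2", OF _ smooth_Gamma])
      (use that in \<open>auto intro!: monoI\<close>)
  have diff: "H_map \<Gamma> k i differentiable (at X)" if "0 < k" "k \<le> r" for k i X
    by (rule C_k_on_imp_differentiable[OF smooth_H[where m = "Suc 0"]]) (use that in auto)
  have smooth_Gamma1: "C_k_on (Suc 0) UNIV (\<Gamma> i)" for i
    using smooth_H[of 1 "Suc 0" i] by simp
  have cont_Gamma: "continuous_on UNIV (\<Gamma> i)" for i
    by (rule C_k_on_imp_continuous_on[OF smooth_Gamma1])

  \<comment> \<open>The recursion rearranged: the summand \<open>k = 1\<close> is
    \<open>\<Gamma> (m - 1)\<close>, so the formula says that both expansions have the same
    coefficient of \<open>h^m\<close>.\<close>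
  have coeff: "(1 / fact m) *\<^sub>R Phi_coeff \<Phi> m X = (\<Sum>k=1..m. (1 / fact k) *\<^sub>R H_map \<Gamma> k (m - k) X)"
    if m: "1 \<le> m" "m \<le> r + 1" for m X
  proof -
    have "\<Gamma> (m - 1) X = gamma_formula \<Phi> \<Gamma> (m - 1) X"
      using formula[of "m - 1"] m by simp
    moreover have "(\<Sum>k=1..m. (1 / fact k) *\<^sub>R H_map \<Gamma> k (m - k) X)
        = \<Gamma> (m - 1) X + (\<Sum>k=2..m. (1 / fact k) *\<^sub>R H_map \<Gamma> k (m - k) X)"
      using m by (subst sum.atLeast_Suc_atMost) (auto simp: numeral_2_eq_2)
    ultimately show ?thesis
      using m by (simp add: gamma_formula_def)
  qed

  have close: "\<forall>\<^sub>F h in at_right 0. \<forall>x. solves_ivp (resolution_field r \<Gamma> h) h X x \<longrightarrow>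
      norm (x h - \<Phi> X h) \<le> e * h ^ (r + 1)" if "e > 0" for e X
  proof -
    \<comment> \<open>Three errors are added: the Taylor remainder of the solution, the discarded
      powers of \<open>h\<close>, and the Taylor remainder of the template.\<close>
    have e3: "e / 3 > 0" using that by simp
    have "\<forall>\<^sub>F h in at_right 0. \<forall>x. solves_ivp (resolution_field r \<Gamma> h) h X x \<longrightarrow>
      norm (x h - (\<Sum>k\<le>r + 1. (h ^ k / fact k) *\<^sub>R flow_derivative \<Gamma> B k h X)) \<le> e / 3 * h ^ (r + 1)"
      by (rule solution_expansion[OF zero _ _ _ e3]) (use smooth_H diff in \<open>auto simp: B_def\<close>)
    moreover have "\<forall>\<^sub>F h in at_right 0. norm ((\<Sum>k\<le>r + 1. (h ^ k / fact k) *\<^sub>R flow_derivative \<Gamma> B k h X)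
        - (\<Sum>m\<le>r + 1. (h ^ m / fact m) *\<^sub>R Phi_coeff \<Phi> m X)) \<le> e / 3 * h ^ (r + 1)"
      by (rule flow_coefficients_match[OF coeff _ _ e3]) (auto simp: Phi_coeff_def id0 B_def)
    moreover have "\<forall>\<^sub>F h in at_right 0.
        norm (\<Phi> X h - (\<Sum>m\<le>r + 1. (h ^ m / fact m) *\<^sub>R Phi_coeff \<Phi> m X)) \<le> e / 3 * h ^ (r + 1)"
      by (rule template_expansion[OF smooth _ e3]) simp
    ultimately show ?thesis
    proof eventually_elim
      case (elim h)
      show ?case
      proof (intro allI impI)
        fix x assume "solves_ivp (resolution_field r \<Gamma> h) h X x"
        then have "norm (x h - (\<Sum>k\<le>r + 1. (h ^ k / fact k) *\<^sub>R flow_derivative \<Gamma> B k h X)) \<le> e / 3 * h ^ (r + 1)"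
          using elim(1) by blast
        moreover have "norm (a - d) \<le> norm (a - b) + norm (b - c) + norm (d - c)" for a b c d :: 'a
          using norm_triangle_ineq[of "a - b" "b - c"] norm_triangle_ineq4[of "a - c" "d - c"] by simp
        ultimately have "norm (x h - \<Phi> X h) \<le> e / 3 * h ^ (r + 1) + e / 3 * h ^ (r + 1) + e / 3 * h ^ (r + 1)"
          using elim(2,3) by (meson add_mono order_trans)
        then show "norm (x h - \<Phi> X h) \<le> e * h ^ (r + 1)" by simp
      qed
    qed
  qed

  have ode: "resolution_ode r \<Phi> \<Gamma>"
    by (rule resolution_odeI[OF cont_Gamma eventually_solution_exists[OF smooth_Gamma1] close])

  have unique: "\<Gamma>' j = \<Gamma> j" if ode': "resolution_ode r \<Phi> \<Gamma>'" and "j \<le> r" for \<Gamma>' j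
    using \<open>j \<le> r\<close>
  \<comment> \<open>Strong induction replaces the choice of the first index at which the
    coefficients differ.\<close>
  proof (induction j rule: less_induct)
    case (less j)
    show ?case
    proof
      fix X
      show "\<Gamma>' j X = \<Gamma> j X"
      proof (rule resolution_coeff_unique[OF _ smooth_Gamma1 _ \<open>j \<le> r\<close>])
        show "continuous_on UNIV (\<Gamma>' i)" if "i \<le> r" for i
          using ode' that by (simp add: resolution_ode_def)
        show "\<Gamma>' i = \<Gamma> i" if "i < j" for i
          using less that by simp
        fix e :: real assume "e > 0"
        then have e2: "e / 2 > 0" by simp
        from resolution_odeD[OF ode' e2, of X] resolution_odeD[OF ode e2, of X]
        show "\<forall>\<^sub>F h in at_right 0. \<exists>x y. solves_ivp (resolution_field r \<Gamma>' h) h X x \<and>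
          solves_ivp (resolution_field r \<Gamma> h) h X y \<and> norm (x h - y h) \<le> e * h ^ (r + 1)"
        proof eventually_elim
          case (elim h)
          then obtain x y where "solves_ivp (resolution_field r \<Gamma>' h) h X x"
            "solves_ivp (resolution_field r \<Gamma> h) h X y"
            and xy: "norm (x h - \<Phi> X h) \<le> e / 2 * h ^ (r + 1)" "norm (y h - \<Phi> X h) \<le> e / 2 * h ^ (r + 1)"
            by blast
          moreover have "norm (x h - y h) \<le> e * h ^ (r + 1)"
            using norm_triangle_le_diff[of "x h - \<Phi> X h" "y h - \<Phi> X h"] xy by simp
          ultimately show ?case by blast
        qed
      qed
    qed
  qed

  show ?thesis
  proof (intro exI[of _ \<Gamma>] conjI ballI allI impI)
    show "resolution_ode r \<Phi> \<Gamma>" by (rule ode)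
    show "\<Gamma>' j = \<Gamma> j" if "resolution_ode r \<Phi> \<Gamma>'" "j \<le> r" for \<Gamma>' j
      using that by (rule unique)
    show "H_map \<Gamma> k i differentiable (at X)" if "k \<in> {1..r}" for k i X
      using that by (intro diff) auto
    show "\<Gamma> 0 X = Phi_coeff \<Phi> 1 X" for X
      using coeff[of 1 X] by simp
    show "\<Gamma> j X = (1 / fact (j + 1)) *\<^sub>R Phi_coeff \<Phi> (j + 1) X
        - (\<Sum>k=2..j+1. (1 / fact k) *\<^sub>R H_map \<Gamma> k (j + 1 - k) X)" if "j \<in> {1..r}" for j X
      using that by (subst formula) (auto simp: gamma_formula_def)
  qed
qed

end
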